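(* Let $m\ge 3$, $n,r\ge 1$, $1\le p\le m-2$ and $p\le k\le n-m+p$ be integers with $\binom{k}{p}\ge r$ and $\binom{n-k-1}{m-p-1}\ge r$. Let $$\mathcal F_m=\sum_{i=1}^r\lambda_i\begin{bmatrix} 1 \\ u_i \end{bmatrix}^{\otimes m}\in \mathrm S^m(\mathbb C^{n+1}),\qquad u_i\in\mathbb C^n,\ \lambda_i\in\mathbb C\setminus\{0\}.$$ Suppose that the vectors $\{[u_i]_{\mathscr B_0}\}_{i=1}^r$ are linearly independent, that for every $\alpha\in\mathscr B_1$ the vectors $\{[u_i]_{\mathcal O_\alpha}\}_{i=1}^r$ are linearly independent, and that the matrix $N(\xi)$ has distinct eigenvalues. Then the incomplete symmetric tensor decomposition algorithm (described in the context), applied to the subtensor $(\mathcal F_m)_{\Omega_m}$, finds the unique rank-$r$ decomposition of $\mathcal F_m$; that is, its output vectors satisfy $\mathcal F_m=q_1^{\otimes m}+\cdots+q_r^{\otimes m}$, and this is the unique rank-$r$ decomposition of $\mathcal F_m$ (up to permutation of the summands).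
   Context: $\mathrm S^m(\mathbb C^{n+1})$ is the space of symmetric tensors of order $m$ over $\mathbb C^{n+1}$; tensor indices run over $0,1,\dots,n$. With $x=(x_1,\dots,x_n)$ and $x_0:=1$, the entries of $\mathcal F\in\mathrm S^m(\mathbb C^{n+1})$ are also labelled by $\alpha\in\mathbb N^n$ with $|\alpha|\le m$ (or by the monomial $x^\alpha$): $\mathcal F_\alpha=\mathcal F_{i_1\dots i_m}$ whenever $x_0^{m-|\alpha|}x^\alpha=x_{i_1}\cdots x_{i_m}$. Monomials are identified with their exponents. $\Omega_m$ is the set of index tuples $(i_1,\dots,i_m)$ with pairwise distinct entries, and $(\cdot)_{\Omega_m}$ denotes restriction to these entries. $\|\cdot\|$ is the Euclidean (Hilbert–Schmidt) norm; $c^{1/m}$ is the principal $m$th root. A rank-$r$ decomposition of $\mathcal F$ is an expression of $\mathcal F$ as a sum of $r$ terms $q_i^{\otimes m}$, $r$ being the symmetric rank (minimal number of terms). $\mathscr B_0$: the first $r$ monomials, in graded lexicographic order, of $\{x_{i_1}\cdots x_{i_p}:1\le i_1<\dots<i_p\le k\}$. $\mathscr B_1=\{x_{j_1}\cdots x_{j_{p+1}}:1\le j_1<\dots<j_p\le k<j_{p+1}\le n\}$. For $\alpha=e_{j_1}+\dots+e_{j_{p+1}}\in\mathscr B_1$ (with $j_{p+1}>k$), $\mathcal O_\alpha$ is the set of tuples $(s_1,\dots,s_{m-p-1})$ with $k+1\le s_1<\dots<s_{m-p-1}\le n$ and all $s_t\ne j_{p+1}$, identified with monomials $x_{s_1}\cdots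 x_{s_{m-p-1}}$. For a finite set $\mathscr B$ of monomials and a vector $v$, $[v]_{\mathscr B}=(f(v))_{f\in\mathscr B}$. Matrix $A[\alpha,\mathcal F_m]$ and vector $b[\alpha,\mathcal F_m]$: $A[\alpha,\mathcal F_m]_{\gamma,\beta}=(\mathcal F_m)_{\beta+\gamma}$, $b[\alpha,\mathcal F_m]_\gamma=(\mathcal F_m)_{\alpha+\gamma}$ for $\gamma\in\mathcal O_\alpha$, $\beta\in\mathscr B_0$. Index sets: $J_1=\{x_{i_1}\cdots x_{i_p}:1\le i_1<\dots<i_p\le k\}$; $J_1^{-j}$ is the set of monomials in $J_1$ not involving $x_j$; $J_2=\{x_{i_1}\cdots x_{i_{m-p-1}}:k+1\le i_1<\dots<i_{m-p-1}\le n\}$; $J_3=\{x_{i_1-k}\cdots x_{i_{m-p-1}-k}: x_{i_1}\cdots x_{i_{m-p-1}}\in J_2\}$. Products such as $J_1\cdot J_2$ mean sets of products of monomials, arranged as matrices/tensors. Algorithm (input $r$, $d=n+1$, $p$, and $(\mathcal F_m)_{\Omega_m}$): Step 1. For each $\alpha\in\mathscr B_1$ solve $A[\alpha,\mathcal F_m]\,G(:,\alpha)=b[\alpha,\mathcal F_m]$ to obtain $G\in\mathbb C^{\mathscr B_0\times\mathscr B_1}$. Step 2. For $l=k+1,\dots,n$ let $N_l(G)\in\mathbb C^{r\times r}$ be given by $N_l(G)_{\nu,\beta}=G(\beta,\nu+e_l)$, $\nu,\beta\in\mathscr B_0$. For a (randomly) selected vector $\xi=(\xi_{k+1},\dots,\xi_n)$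 let $N(\xi)=\sum_{l=k+1}^n\xi_lN_l(G)$, let $z_1,\dots,z_r$ be unit-length eigenvectors of $N(\xi)$, and set $\tilde w_i=(z_i^HN_{k+1}(G)z_i,\dots,z_i^HN_n(G)z_i)\in\mathbb C^{n-k}$. Step 3. Let $(\tilde\gamma_1,\dots,\tilde\gamma_r)$, $\tilde\gamma_i\in\mathbb C^{J_1}$, be the minimizer of $\|(\mathcal F_m)_{J_1\cdot J_2}-\sum_i\gamma_i\otimes[\tilde w_i]_{J_3}\|^2$. For each $j\in\{1,\dots,k\}$ let $((\tilde v_1)_j,\dots,(\tilde v_r)_j)$ be the minimizer of $\|(\mathcal F_m)_{x_j\cdot J_1^{-j}\cdot J_2}-\sum_i(v_i)_j\,\tilde\gamma_i\otimes[\tilde w_i]_{J_3}\|^2$, where $\tilde\gamma_i$ is restricted to the labels in $J_1^{-j}$. With $\tilde u_i=(\tilde v_i,\tilde w_i)$, let $(\tilde\lambda_1,\dots,\tilde\lambda_r)$ be the minimizer of $\|(\mathcal F_m)_{\Omega_m}-\sum_i\lambda_i((1,\tilde u_i)^{\otimes m})_{\Omega_m}\|^2$. Output: $q_i=(\tilde\lambda_i)^{1/m}(1,\tilde v_i,\tilde w_i)$, $i=1,\dots,r$.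
   Formalization: The algorithm is shown to have an output exactly when every [u_i] restricted to J_1^{-j} (1≤j≤k) is nonzero; otherwise the minimizer for (v_i)_j in Step 3 is not unique (e.g. m=n=3, p=k=r=1, u=(1,1,1)). Correctness of any output, rank r and uniqueness hold unconditionally. *)

theory Defs
  imports
    "HOL-Analysis.Analysis"
    "HOL-Library.Multiset"
    "HOL-Library.List_Lexorder"
    "HOL-Combinatorics.Permutations"
    "Jordan_Normal_Form.Spectral_Radius"
begin

section \<open>Tensors\<close>

text \<open>
  A vector in \<open>\<complex>\<^sup>n\<close> is a function whose values at \<open>1, \<dots>, n\<close> matter, a vector in \<open>\<complex>\<^sup>n\<^sup>+\<^sup>1\<close>
  one whose values at \<open>0, \<dots>, n\<close> matter. A tensor of order \<open>m\<close> over \<open>\<complex>\<^sup>n\<^sup>+\<^sup>1\<close> is a function on index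
  tuples (lists) whose values on \<open>tuples m n\<close> matter; accordingly, equality of tensors is
  \<open>tensor_eq\<close>. Families of \<open>r\<close> objects are indexed by \<open>0, \<dots>, r - 1\<close>.
\<close>

type_synonym tensor = "nat list \<Rightarrow> complex"

definition tuples :: "nat \<Rightarrow> nat \<Rightarrow> nat list set" where
  "tuples m n = {is. length is = m \<and> set is \<subseteq> {0..n}}"

definition Omega :: "nat \<Rightarrow> nat \<Rightarrow> nat list set" where
  "Omega m n = {is \<in> tuples m n. distinct is}"

definition tensor_eq :: "nat \<Rightarrow> nat \<Rightarrow> tensor \<Rightarrow> tensor \<Rightarrow> bool" where
  "tensor_eq m n F H \<longleftrightarrow> (\<forall>is \<in> tuples m n. F is = H is)"

text \<open>The entries of \<open>q\<^sup>\<otimes>\<^sup>m\<close>; the order \<open>m\<close> is the length of the tuple.\<close>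

definition tensor_power :: "(nat \<Rightarrow> complex) \<Rightarrow> tensor" where
  "tensor_power q is = prod_list (map q is)"

definition hom1 :: "(nat \<Rightarrow> complex) \<Rightarrow> nat \<Rightarrow> complex" where
  "hom1 u = u(0 := 1)"

definition decomposes :: "nat \<Rightarrow> nat \<Rightarrow> nat \<Rightarrow> tensor \<Rightarrow> (nat \<Rightarrow> nat \<Rightarrow> complex) \<Rightarrow> bool" where
  "decomposes m n r F q \<longleftrightarrow> tensor_eq m n F (\<lambda>is. \<Sum>i<r. tensor_power (q i) is)"

definition symmetric_rank :: "nat \<Rightarrow> nat \<Rightarrow> tensor \<Rightarrow> nat" where
  "symmetric_rank m n F = (LEAST s. \<exists>q. decomposes m n s F q)"

definition rank_decomposition ::
    "nat \<Rightarrow> nat \<Rightarrow> nat \<Rightarrow> tensor \<Rightarrow> (nat \<Rightarrow> nat \<Rightarrow> complex) \<Rightarrow> bool" where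
  "rank_decomposition m n r F q \<longleftrightarrow> symmetric_rank m n F = r \<and> decomposes m n r F q"


section \<open>Monomials\<close>

text \<open>
  A monomial in \<open>x\<^sub>1, x\<^sub>2, \<dots>\<close> is the multiset of its variable indices: \<open>count \<alpha> i\<close> is the exponent of
  \<open>x\<^sub>i\<close>, \<open>size \<alpha>\<close> the degree, \<open>+\<close> the product, and \<open>{#l#}\<close> is \<open>e\<^sub>l\<close>.
\<close>

type_synonym mono = "nat multiset"

definition mono_eval :: "mono \<Rightarrow> (nat \<Rightarrow> complex) \<Rightarrow> complex" where
  "mono_eval \<alpha> u = (\<Prod>i\<in>#\<alpha>. u i)"

text \<open>The entry \<open>F\<^sub>\<alpha>\<close>, read off at the nondecreasing tuple of \<open>x\<^sub>0\<^bsup>m - |\<alpha>|\<^esup> x\<^sup>\<alpha>\<close>.\<close>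

definition entry :: "nat \<Rightarrow> tensor \<Rightarrow> mono \<Rightarrow> complex" where
  "entry m F \<alpha> = F (sorted_list_of_multiset (replicate_mset (m - size \<alpha>) 0 + \<alpha>))"

text \<open>The monomials \<open>x\<^bsub>i\<^sub>1\<^esub> \<cdots> x\<^bsub>i\<^sub>d\<^esub>\<close> with \<open>i\<^sub>1 < \<dots> < i\<^sub>d\<close> in \<open>S\<close>.\<close>

definition sqfree_monos :: "nat set \<Rightarrow> nat \<Rightarrow> mono set" where
  "sqfree_monos S d = {mset_set I |I. I \<subseteq> S \<and> card I = d}"

definition J1 :: "nat \<Rightarrow> nat \<Rightarrow> mono set" where
  "J1 k p = sqfree_monos {1..k} p"

definition J1_minus :: "nat \<Rightarrow> nat \<Rightarrow> nat \<Rightarrow> mono set" where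
  "J1_minus k p j = {\<beta> \<in> J1 k p. j \<notin># \<beta>}"

definition J2 :: "nat \<Rightarrow> nat \<Rightarrow> nat \<Rightarrow> nat \<Rightarrow> mono set" where
  "J2 m n k p = sqfree_monos {k+1..n} (m - p - 1)"

text \<open>The bijection from \<open>J\<^sub>2\<close> onto \<open>J\<^sub>3\<close> that lowers every index by \<open>k\<close>.\<close>

definition down :: "nat \<Rightarrow> mono \<Rightarrow> mono" where
  "down k \<gamma> = image_mset (\<lambda>i. i - k) \<gamma>"

text \<open>
  The list of \<open>\<B>\<^sub>0\<close>. All monomials in \<open>J\<^sub>1\<close> have degree \<open>p\<close>, so the graded lexicographic order (with
  \<open>x\<^sub>1\<close> before \<open>x\<^sub>2\<close> and so on) is the lexicographic order on their increasing index tuples, as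
  provided by the order on lists.
\<close>

definition B0_list :: "nat \<Rightarrow> nat \<Rightarrow> nat \<Rightarrow> mono list" where
  "B0_list k p r = take r (map mset (sorted_list_of_set (sorted_list_of_multiset ` J1 k p)))"

definition B0 :: "nat \<Rightarrow> nat \<Rightarrow> nat \<Rightarrow> mono set" where
  "B0 k p r = set (B0_list k p r)"

definition B1 :: "nat \<Rightarrow> nat \<Rightarrow> nat \<Rightarrow> mono set" where
  "B1 n k p = {\<beta> + {#l#} |\<beta> l. \<beta> \<in> J1 k p \<and> l \<in> {k+1..n}}"

text \<open>For \<open>\<alpha> \<in> \<B>\<^sub>1\<close> the only index exceeding \<open>k\<close> in \<open>\<alpha>\<close> is \<open>j\<^bsub>p+1\<^esub>\<close>, so this removes just \<open>j\<^bsub>p+1\<^esub>\<close>.\<close>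

definition O_set :: "nat \<Rightarrow> nat \<Rightarrow> nat \<Rightarrow> nat \<Rightarrow> mono \<Rightarrow> mono set" where
  "O_set m n k p \<alpha> = sqfree_monos ({k+1..n} - set_mset \<alpha>) (m - p - 1)"

text \<open>Linear independence of the family \<open>[u\<^sub>i]\<^sub>B\<close>, \<open>i < r\<close>.\<close>

definition lin_indep_on :: "nat \<Rightarrow> (nat \<Rightarrow> nat \<Rightarrow> complex) \<Rightarrow> mono set \<Rightarrow> bool" where
  "lin_indep_on r u B \<longleftrightarrow>
     (\<forall>c :: nat \<Rightarrow> complex. (\<forall>f\<in>B. (\<Sum>i<r. c i * mono_eval f (u i)) = 0) \<longrightarrow> (\<forall>i<r. c i = 0))"


section \<open>The algorithm\<close>

text \<open>
  \<open>T\<close> is always the input subtensor; only its values on \<open>Omega m n\<close> are used.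
  \<open>G \<beta> \<alpha>\<close> is \<open>G(\<beta>, \<alpha>)\<close>.
\<close>

definition A_entry :: "nat \<Rightarrow> tensor \<Rightarrow> mono \<Rightarrow> mono \<Rightarrow> complex" where
  "A_entry m T \<gamma> \<beta> = entry m T (\<beta> + \<gamma>)"

definition b_entry :: "nat \<Rightarrow> tensor \<Rightarrow> mono \<Rightarrow> mono \<Rightarrow> complex" where
  "b_entry m T \<alpha> \<gamma> = entry m T (\<alpha> + \<gamma>)"

definition step1 ::
    "nat \<Rightarrow> nat \<Rightarrow> nat \<Rightarrow> nat \<Rightarrow> nat \<Rightarrow> tensor \<Rightarrow> (mono \<Rightarrow> mono \<Rightarrow> complex) \<Rightarrow> bool" where
  "step1 m n k p r T G \<longleftrightarrow>
     (\<forall>\<alpha> \<in> B1 n k p. \<forall>\<gamma> \<in> O_set m n k p \<alpha>.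
        (\<Sum>\<beta> \<in> B0 k p r. A_entry m T \<gamma> \<beta> * G \<beta> \<alpha>) = b_entry m T \<alpha> \<gamma>)"

text \<open>Rows and columns are numbered along \<open>B0_list\<close>.\<close>

definition N_mat ::
    "nat \<Rightarrow> nat \<Rightarrow> nat \<Rightarrow> (mono \<Rightarrow> mono \<Rightarrow> complex) \<Rightarrow> nat \<Rightarrow> complex mat" where
  "N_mat k p r G l =
     mat r r (\<lambda>(a, b). G (B0_list k p r ! b) (B0_list k p r ! a + {#l#}))"

definition N_xi ::
    "nat \<Rightarrow> nat \<Rightarrow> nat \<Rightarrow> nat \<Rightarrow> (mono \<Rightarrow> mono \<Rightarrow> complex) \<Rightarrow> (nat \<Rightarrow> complex) \<Rightarrow> complex mat" where
  "N_xi n k p r G \<xi> = mat r r (\<lambda>ab. \<Sum>l = k+1..n. \<xi> l * (N_mat k p r G l $$ ab))"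

definition distinct_eigenvalues :: "complex mat \<Rightarrow> bool" where
  "distinct_eigenvalues N \<longleftrightarrow> card (spectrum N) = dim_row N"

text \<open>
  \<open>z\<^sub>i\<close> are unit eigenvectors for pairwise different eigenvalues. Below, \<open>(N z) \<bullet>c z\<close> is \<open>z\<^sup>H N z\<close>,
  the second argument of \<open>\<bullet>c\<close> being conjugated.
\<close>

definition unit_eigenvectors :: "nat \<Rightarrow> complex mat \<Rightarrow> (nat \<Rightarrow> complex vec) \<Rightarrow> bool" where
  "unit_eigenvectors r N z \<longleftrightarrow>
     (\<exists>\<mu>. inj_on \<mu> {..<r} \<and> (\<forall>i<r. eigenvector N (z i) (\<mu> i) \<and> z i \<bullet>c z i = 1))"

definition step2 ::
    "nat \<Rightarrow> nat \<Rightarrow> nat \<Rightarrow> nat \<Rightarrow> (nat \<Rightarrow> complex) \<Rightarrow> (mono \<Rightarrow> mono \<Rightarrow> complex)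
       \<Rightarrow> (nat \<Rightarrow> nat \<Rightarrow> complex) \<Rightarrow> bool" where
  "step2 n k p r \<xi> G w \<longleftrightarrow>
     (\<exists>z. unit_eigenvectors r (N_xi n k p r G \<xi>) z \<and>
          (\<forall>i<r. \<forall>t\<in>{1..n-k}. w i t = (N_mat k p r G (k + t) *\<^sub>v z i) \<bullet>c z i))"

text \<open>
  ``\<open>x\<close> is the minimizer of \<open>f\<close> over \<open>S\<close>'': a minimizer exists and \<open>x\<close> is the only one. The feasible
  sets below are extensional function spaces, so that uniqueness is not spoilt by function values
  at irrelevant arguments. The minimizer of \<open>obj_v\<close> is not unique if some \<open>g i\<close> vanishes on
  \<open>J1_minus k p j\<close> (in particular if \<open>k = p\<close>, where this set is empty); the algorithm then has no output.
\<close>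

definition the_minimizer :: "('a \<Rightarrow> real) \<Rightarrow> 'a set \<Rightarrow> 'a \<Rightarrow> bool" where
  "the_minimizer f S x \<longleftrightarrow>
     is_arg_min f (\<lambda>y. y \<in> S) x \<and> (\<forall>y. is_arg_min f (\<lambda>y. y \<in> S) y \<longrightarrow> y = x)"

definition obj_gamma ::
    "nat \<Rightarrow> nat \<Rightarrow> nat \<Rightarrow> nat \<Rightarrow> nat \<Rightarrow> tensor \<Rightarrow> (nat \<Rightarrow> nat \<Rightarrow> complex)
       \<Rightarrow> (nat \<Rightarrow> mono \<Rightarrow> complex) \<Rightarrow> real" where
  "obj_gamma m n k p r T w g =
     (\<Sum>\<beta> \<in> J1 k p. \<Sum>\<gamma> \<in> J2 m n k p.
        (cmod (entry m T (\<beta> + \<gamma>) - (\<Sum>i<r. g i \<beta> * mono_eval (down k \<gamma>) (w i))))\<^sup>2)"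

definition obj_v ::
    "nat \<Rightarrow> nat \<Rightarrow> nat \<Rightarrow> nat \<Rightarrow> nat \<Rightarrow> tensor \<Rightarrow> (nat \<Rightarrow> nat \<Rightarrow> complex)
       \<Rightarrow> (nat \<Rightarrow> mono \<Rightarrow> complex) \<Rightarrow> nat \<Rightarrow> (nat \<Rightarrow> complex) \<Rightarrow> real" where
  "obj_v m n k p r T w g j y =
     (\<Sum>\<beta> \<in> J1_minus k p j. \<Sum>\<gamma> \<in> J2 m n k p.
        (cmod (entry m T ({#j#} + \<beta> + \<gamma>)
               - (\<Sum>i<r. y i * g i \<beta> * mono_eval (down k \<gamma>) (w i))))\<^sup>2)"

definition obj_lambda ::
    "nat \<Rightarrow> nat \<Rightarrow> nat \<Rightarrow> tensor \<Rightarrow> (nat \<Rightarrow> nat \<Rightarrow> complex) \<Rightarrow> (nat \<Rightarrow> complex) \<Rightarrow> real" where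
  "obj_lambda m n r T u c =
     (\<Sum>is \<in> Omega m n. (cmod (T is - (\<Sum>i<r. c i * tensor_power (hom1 (u i)) is)))\<^sup>2)"

text \<open>\<open>v j i\<close> is \<open>(v\<^sub>i)\<^sub>j\<close>, so that \<open>v j\<close> is the vector determined by the \<open>j\<close>-th problem.\<close>

definition join :: "nat \<Rightarrow> (nat \<Rightarrow> nat \<Rightarrow> complex) \<Rightarrow> (nat \<Rightarrow> nat \<Rightarrow> complex) \<Rightarrow> nat \<Rightarrow> nat \<Rightarrow> complex" where
  "join k v w i = (\<lambda>j. if j \<le> k then v j i else w i (j - k))"

definition step3 ::
    "nat \<Rightarrow> nat \<Rightarrow> nat \<Rightarrow> nat \<Rightarrow> nat \<Rightarrow> tensor \<Rightarrow> (nat \<Rightarrow> nat \<Rightarrow> complex)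
       \<Rightarrow> (nat \<Rightarrow> nat \<Rightarrow> complex) \<Rightarrow> (nat \<Rightarrow> complex) \<Rightarrow> bool" where
  "step3 m n k p r T w v c \<longleftrightarrow>
     (\<exists>g. the_minimizer (obj_gamma m n k p r T w) ({..<r} \<rightarrow>\<^sub>E (J1 k p \<rightarrow>\<^sub>E UNIV)) g \<and>
          (\<forall>j\<in>{1..k}. the_minimizer (obj_v m n k p r T w g j) ({..<r} \<rightarrow>\<^sub>E UNIV) (v j)) \<and>
          the_minimizer (obj_lambda m n r T (join k v w)) ({..<r} \<rightarrow>\<^sub>E UNIV) c)"

text \<open>
  \<open>q\<close> is an output of the algorithm on \<open>T\<close> for the selected vector \<open>\<xi>\<close>. On complex numbers, \<open>powr\<close>
  is the principal power.
\<close>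

definition algorithm_output ::
    "nat \<Rightarrow> nat \<Rightarrow> nat \<Rightarrow> nat \<Rightarrow> nat \<Rightarrow> (nat \<Rightarrow> complex) \<Rightarrow> tensor \<Rightarrow> (nat \<Rightarrow> nat \<Rightarrow> complex) \<Rightarrow> bool"
  where
  "algorithm_output m n k p r \<xi> T q \<longleftrightarrow>
     (\<exists>G w v c. step1 m n k p r T G \<and> step2 n k p r \<xi> G w \<and> step3 m n k p r T w v c \<and>
        (\<forall>i<r. \<forall>j\<in>{0..n}. q i j = c i powr (1 / of_nat m) * hom1 (join k v w i) j))"

end

theory Submission
  imports Defs
begin

text \<open>
  The entries of \<open>F\<close> at squarefree monomials of degree \<open>m - 1\<close> or \<open>m\<close> are the power sums
  \<open>\<Sum>\<^sub>i \<lambda>\<^sub>i x\<^sup>\<alpha>(u\<^sub>i)\<close>, and the algorithm only ever reads such entries. Everything rests on splitting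
  \<open>x\<^sup>\<alpha>\<close> into a factor in the first \<open>k\<close> variables and a factor in the last \<open>n - k\<close> variables: the
  entries \<open>F\<^bsub>\<beta>+\<gamma>\<^esub>\<close> with \<open>\<beta> \<in> \<B>\<^sub>0\<close> and \<open>\<gamma> \<in> J\<^sub>2\<close> form a matrix \<open>\<Sum>\<^sub>i \<lambda>\<^sub>i [u\<^sub>i]\<^bsub>\<B>\<^sub>0\<^esub> \<otimes> [u\<^sub>i]\<^bsub>J\<^sub>2\<^esub>\<close>
  of rank \<open>r\<close> whose two families of factors are linearly independent.

  \<^emph>\<open>Correctness.\<close> In the equations for \<open>G\<close>, the independence of \<open>[u\<^sub>i]\<close> on \<open>\<O>\<^sub>\<alpha>\<close> strips off the
  second factor, so that \<open>G\<close> solves them if and only if it interpolates: \<open>\<Sum>\<^sub>\<beta> G(\<beta>,\<alpha>) x\<^sup>\<beta>\<close> agrees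
  with \<open>x\<^sup>\<alpha>\<close> at every \<open>u\<^sub>i\<close> (\<open>step1_iff_interpolation\<close>). Hence each \<open>N\<^sub>l(G)\<close> acts on \<open>[u\<^sub>i]\<^bsub>\<B>\<^sub>0\<^esub>\<close>
  as multiplication by \<open>(u\<^sub>i)\<^sub>l\<close>. These \<open>r\<close> vectors form a basis, so if \<open>N(\<xi>)\<close> has distinct
  eigenvalues, they are its only eigenvectors up to scalars
  (\<open>eigenvector_is_multiple_of_B0_vec\<close>), and \<open>z\<^sub>i\<^sup>H N\<^sub>l z\<^sub>i\<close> is the \<open>l\<close>-th coordinate of some \<open>u\<^sub>i\<close>. All
  least-squares problems of the last step then have residual zero at the true data; a minimizer is a
  solution of a linear system, and the independence assumptions decide when this solution is unique.
  For the first and the last problem it always is. In the problem for \<open>(v\<^sub>i)\<^sub>j\<close>, the unknown for a given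
  \<open>i\<close> is multiplied by the values \<open>x\<^sup>\<beta>(u\<^sub>i)\<close> with \<open>\<beta>\<close> in \<open>J\<^sub>1\<close> not involving \<open>x\<^sub>j\<close>, and is fixed exactly
  if one of them is nonzero. This is the criterion for the existence of an output.

  \<^emph>\<open>Uniqueness.\<close> Suppose that \<open>F\<close> is also the sum of \<open>r\<close> powers \<open>q\<^sub>i\<^sup>\<otimes>\<^sup>m\<close>. A matrix of rank \<open>r\<close>
  written as a sum of \<open>r\<close> products has independent factors (\<open>indep_of_same_bilinear_sum\<close>).
  Applied to \<open>F\<^bsub>\<beta>+\<gamma>\<^esub>\<close>, which carries the factor \<open>(q\<^sub>i)\<^sub>0\<close> since its degree is \<open>m - 1\<close>, this gives
  \<open>(q\<^sub>i)\<^sub>0 \<noteq> 0\<close>; padding with zero vectors, it also shows that fewer than \<open>r\<close> powers cannot suffice.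
  After scaling to first coordinate \<open>1\<close>, the same lemma shows that the new decomposition
  satisfies all the independence assumptions (\<open>decomposition_is_generic\<close>). The matrix \<open>N(\<xi>)\<close>
  depends only on \<open>F\<close>, so both decompositions describe its eigenvectors; comparing them
  matches the points in the last \<open>n - k\<close> coordinates, and comparing coefficients of the independent
  vectors \<open>[u\<^sub>i]\<^bsub>J\<^sub>2\<^esub>\<close> matches the remaining coordinates and the weights.
\<close>

section \<open>Linearly independent families and least squares\<close>

text \<open>
  The general form of \<open>lin_indep_on\<close>: the vectors \<open>a i\<close> need not consist of values of monomials. The
  factors of bilinear sums below carry weights.
\<close>

definition indep :: "nat \<Rightarrow> (nat \<Rightarrow> 'a \<Rightarrow> complex) \<Rightarrow> 'a set \<Rightarrow> bool" where
  "indep r a X \<longleftrightarrow> (\<forall>c. (\<forall>x\<in>X. (\<Sum>i<r. c i * a i x) = 0) \<longrightarrow> (\<forall>i<r. c i = 0))"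

lemma indepD: "indep r a X \<Longrightarrow> (\<And>x. x \<in> X \<Longrightarrow> (\<Sum>i<r. c i * a i x) = 0) \<Longrightarrow> i < r \<Longrightarrow> c i = 0"
  unfolding indep_def by blast

lemma indep_eqD:
  assumes "indep r a X" "\<And>x. x \<in> X \<Longrightarrow> (\<Sum>i<r. c i * a i x) = (\<Sum>i<r. d i * a i x)" "i < r"
  shows "c i = d i"
  using indepD[OF assms(1), of "\<lambda>i. c i - d i" i] assms(2,3)
  by (simp add: left_diff_distrib sum_subtractf)

lemma indep_mono: "indep r a X \<Longrightarrow> X \<subseteq> Y \<Longrightarrow> indep r a Y"
  unfolding indep_def by blast

lemma indep_nonzero:
  assumes "indep r a X" "i < r"
  obtains x where "x \<in> X" "a i x \<noteq> 0"
proof (rule ccontr)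
  assume "\<not> thesis"
  with that have z: "\<And>x. x \<in> X \<Longrightarrow> a i x = 0" by blast
  have "(if i = i then 1 else 0 :: complex) = 0"
    by (rule indepD[OF assms(1), where c = "\<lambda>j. if j = i then 1 else 0"])
      (use assms(2) z in \<open>auto intro!: sum.neutral\<close>)
  then show False by simp
qed

lemma indep_scale:
  assumes "indep r a X" "\<And>i. i < r \<Longrightarrow> s i \<noteq> 0"
  shows "indep r (\<lambda>i x. s i * a i x) X"
  unfolding indep_def
proof (intro allI impI)
  fix c i assume "\<forall>x\<in>X. (\<Sum>i<r. c i * (s i * a i x)) = 0" "i < r"
  then have "c i * s i = 0"
    by (intro indepD[OF assms(1), of "\<lambda>i. c i * s i"]) (auto simp: mult.assoc)
  with assms(2) \<open>i < r\<close> show "c i = 0" by simp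
qed

lemma indep_permute:
  assumes "indep r a X" "\<pi> permutes {..<r}"
  shows "indep r (\<lambda>i. a (\<pi> i)) X"
  unfolding indep_def
proof (intro allI impI)
  fix c i assume c: "\<forall>x\<in>X. (\<Sum>i<r. c i * a (\<pi> i) x) = 0" and i: "i < r"
  have "(\<Sum>i<r. c (inv_into UNIV \<pi> i) * a i x) = (\<Sum>i<r. c i * a (\<pi> i) x)" for x
    using sum.permute[OF assms(2), of "\<lambda>i. c (inv_into UNIV \<pi> i) * a i x"]
    by (simp add: comp_def permutes_inverses[OF assms(2)])
  with c have "c (inv_into UNIV \<pi> (\<pi> i)) = 0"
    using permutes_in_image[OF assms(2)] i
    by (intro indepD[OF assms(1), of "\<lambda>i. c (inv_into UNIV \<pi> i)"]) auto
  then show "c i = 0" by (simp add: permutes_inverses[OF assms(2)])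
qed

text \<open>
  For the inductive step, let \<open>b\<close> be the last vector minus its projection to the span of the earlier
  ones, along the functionals already found. By independence \<open>b\<close> is nonzero at some \<open>x\<^sub>0\<close>. Evaluating such
  residues at \<open>x\<^sub>0\<close> is a functional that kills the earlier vectors but not the last one, and it corrects
  the other functionals.
\<close>

lemma indep_dual:
  assumes "finite X" "indep r a X"
  shows "\<exists>d. \<forall>i<r. \<forall>j<r. (\<Sum>x\<in>X. d i x * a j x) = (if i = j then 1 else 0)"
  using assms(2)
proof (induction r)
  case 0
  then show ?case by simp
next
  case (Suc r)
  have ind: "indep r a X"
    unfolding indep_def
  proof (intro allI impI)
    fix c i assume c: "\<forall>x\<in>X. (\<Sum>i<r. c i * a i x) = 0" and i: "i < r"
    have "(if i < r then c i else 0) = 0"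
      by (rule indepD[OF Suc.prems, where c = "\<lambda>i. if i < r then c i else 0"]) (use c i in auto)
    with i show "c i = 0" by simp
  qed
  from Suc.IH[OF ind] obtain d where
    d: "\<And>i j. i < r \<Longrightarrow> j < r \<Longrightarrow> (\<Sum>x\<in>X. d i x * a j x) = (if i = j then 1 else 0)" by blast
  define t where "t i = (\<Sum>x\<in>X. d i x * a r x)" for i
  define b where "b x = a r x - (\<Sum>j<r. t j * a j x)" for x
  have "\<exists>x0\<in>X. b x0 \<noteq> 0"
  proof (rule ccontr)
    assume "\<not> ?thesis"
    then have "(if r < r then - t r else 1) = 0"
      by (intro indepD[OF Suc.prems, where c = "\<lambda>i. if i < r then - t i else 1"])
        (auto simp: b_def sum_negf)
    then show False by simp
  qed
  then obtain x0 where x0: "x0 \<in> X" "b x0 \<noteq> 0" by blast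
  define e where "e x = ((if x = x0 then 1 else 0) - (\<Sum>j<r. a j x0 * d j x)) / b x0" for x
  have e_sum: "(\<Sum>x\<in>X. e x * f x) = (f x0 - (\<Sum>j<r. a j x0 * (\<Sum>x\<in>X. d j x * f x))) / b x0" for f
  proof -
    have "(\<Sum>x\<in>X. e x * f x)
        = (\<Sum>x\<in>X. ((if x = x0 then f x else 0) - (\<Sum>j<r. a j x0 * (d j x * f x))) / b x0)"
      by (intro sum.cong refl)
        (auto simp: e_def left_diff_distrib sum_distrib_right mult.assoc)
    also have "\<dots> = ((\<Sum>x\<in>X. if x = x0 then f x else 0)
        - (\<Sum>x\<in>X. \<Sum>j<r. a j x0 * (d j x * f x))) / b x0"
      by (simp add: sum_subtractf flip: sum_divide_distrib)
    also have "\<dots> = (f x0 - (\<Sum>x\<in>X. \<Sum>j<r. a j x0 * (d j x * f x))) / b x0"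
      using assms(1) x0 by simp
    also have "(\<Sum>x\<in>X. \<Sum>j<r. a j x0 * (d j x * f x))
        = (\<Sum>j<r. a j x0 * (\<Sum>x\<in>X. d j x * f x))"
      by (subst sum.swap) (simp add: sum_distrib_left)
    finally show ?thesis .
  qed
  have e_old: "(\<Sum>x\<in>X. e x * a i x) = 0" if "i < r" for i
  proof -
    have "(\<Sum>j<r. a j x0 * (\<Sum>x\<in>X. d j x * a i x)) = (\<Sum>j<r. if j = i then a j x0 else 0)"
      by (intro sum.cong refl) (use d that in auto)
    with that show ?thesis by (simp add: e_sum)
  qed
  have "(\<Sum>j<r. a j x0 * (\<Sum>x\<in>X. d j x * a r x)) = (\<Sum>j<r. t j * a j x0)"
    by (intro sum.cong refl) (simp add: t_def mult.commute)
  then have e_new: "(\<Sum>x\<in>X. e x * a r x) = 1"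
    using x0(2) by (simp add: e_sum b_def)
  define d' where "d' i x = (if i < r then d i x - t i * e x else e x)" for i x
  have d'_sum: "(\<Sum>x\<in>X. d' i x * f x) = (\<Sum>x\<in>X. d i x * f x) - t i * (\<Sum>x\<in>X. e x * f x)"
    if "i < r" for i f
    using that by (simp add: d'_def left_diff_distrib sum_subtractf sum_distrib_left mult.assoc)
  have "(\<Sum>x\<in>X. d' i x * a j x) = (if i = j then 1 else 0)" if "i < Suc r" "j < Suc r" for i j
  proof (cases "i < r")
    case True
    with that show ?thesis
      by (cases "j < r") (auto simp: d'_sum d e_old e_new less_Suc_eq simp flip: t_def)
  next
    case False
    then have "i = r" using that by simp
    then have "(\<Sum>x\<in>X. d' i x * a j x) = (\<Sum>x\<in>X. e x * a j x)" by (simp add: d'_def)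
    with that \<open>i = r\<close> show ?thesis by (cases "j < r") (auto simp: e_old e_new less_Suc_eq)
  qed
  then show ?case by blast
qed

lemma square_inverse_swap:
  fixes P Q :: "nat \<Rightarrow> nat \<Rightarrow> complex"
  assumes PQ: "\<And>i j. i < r \<Longrightarrow> j < r \<Longrightarrow> (\<Sum>s<r. P i s * Q s j) = (if i = j then 1 else 0)"
    and ij: "i < r" "j < r"
  shows "(\<Sum>s<r. Q i s * P s j) = (if i = j then 1 else 0)"
proof -
  let ?P = "Matrix.mat r r (\<lambda>(i, j). P i j)" and ?Q = "Matrix.mat r r (\<lambda>(i, j). Q i j)"
  have "?P * ?Q = 1\<^sub>m r"
    by (rule eq_matI) (auto simp: scalar_prod_def PQ atLeast0LessThan)
  then have "?Q * ?P = 1\<^sub>m r"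
    by (rule mat_mult_left_right_inverse[rotated 2]) auto
  then have "(?Q * ?P) $$ (i, j) = 1\<^sub>m r $$ (i, j)" by simp
  with ij show ?thesis by (simp add: scalar_prod_def atLeast0LessThan)
qed

text \<open>
  Contracting both sums with functionals dual to \<open>a\<close> and \<open>b\<close> gives the identity matrix on the left and
  a product \<open>P Q\<close> of square matrices on the right, where \<open>P\<close> is made of the contractions of \<open>a'\<close>. A
  linear relation among the \<open>a'\<close> is a vector in the kernel of the invertible matrix \<open>P\<close>.
\<close>

lemma indep_of_same_bilinear_sum:
  assumes fin: "finite X" "finite Y"
    and ind: "indep r a X" "indep r b Y"
    and eq: "\<And>x y. x \<in> X \<Longrightarrow> y \<in> Y \<Longrightarrow> (\<Sum>i<r. a i x * b i y) = (\<Sum>i<r. a' i x * b' i y)"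
  shows "indep r a' X"
proof -
  obtain d where d: "\<And>i j. i < r \<Longrightarrow> j < r \<Longrightarrow> (\<Sum>x\<in>X. d i x * a j x) = (if i = j then 1 else 0)"
    using indep_dual[OF fin(1) ind(1)] by blast
  obtain e where e: "\<And>i j. i < r \<Longrightarrow> j < r \<Longrightarrow> (\<Sum>y\<in>Y. e i y * b j y) = (if i = j then 1 else 0)"
    using indep_dual[OF fin(2) ind(2)] by blast
  define P where "P i s = (\<Sum>x\<in>X. d i x * a' s x)" for i s
  define Q where "Q s j = (\<Sum>y\<in>Y. e j y * b' s y)" for s j
  have contract: "(\<Sum>s<r. (\<Sum>x\<in>X. d i x * f s x) * (\<Sum>y\<in>Y. e j y * g s y))
      = (\<Sum>x\<in>X. \<Sum>y\<in>Y. d i x * e j y * (\<Sum>s<r. f s x * g s y))" for i j f g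
  proof -
    have "(\<Sum>s<r. (\<Sum>x\<in>X. d i x * f s x) * (\<Sum>y\<in>Y. e j y * g s y))
        = (\<Sum>s<r. \<Sum>x\<in>X. \<Sum>y\<in>Y. d i x * e j y * (f s x * g s y))"
      by (simp add: sum_product mult_ac)
    also have "\<dots> = (\<Sum>x\<in>X. \<Sum>s<r. \<Sum>y\<in>Y. d i x * e j y * (f s x * g s y))"
      by (rule sum.swap)
    also have "\<dots> = (\<Sum>x\<in>X. \<Sum>y\<in>Y. \<Sum>s<r. d i x * e j y * (f s x * g s y))"
      by (intro sum.cong refl sum.swap)
    finally show ?thesis by (simp add: sum_distrib_left)
  qed
  have PQ: "(\<Sum>s<r. P i s * Q s j) = (if i = j then 1 else 0)" if "i < r" "j < r" for i j
  proof -
    have "(\<Sum>s<r. P i s * Q s j)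
        = (\<Sum>s<r. (\<Sum>x\<in>X. d i x * a s x) * (\<Sum>y\<in>Y. e j y * b s y))"
      unfolding P_def Q_def contract by (intro sum.cong refl) (simp add: eq)
    also have "\<dots> = (\<Sum>s<r. if s = i then (if i = j then 1 else 0) else 0)"
      by (intro sum.cong refl) (use that d e in auto)
    finally show ?thesis using that by simp
  qed
  show ?thesis
    unfolding indep_def
  proof (intro allI impI)
    fix c j assume c: "\<forall>x\<in>X. (\<Sum>i<r. c i * a' i x) = 0" and j: "j < r"
    have Pc: "(\<Sum>s<r. P i s * c s) = 0" for i
    proof -
      have "(\<Sum>s<r. P i s * c s) = (\<Sum>s<r. \<Sum>x\<in>X. d i x * (c s * a' s x))"
        by (simp add: P_def sum_distrib_left sum_distrib_right mult_ac)
      also have "\<dots> = (\<Sum>x\<in>X. d i x * (\<Sum>s<r. c s * a' s x))"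
        by (subst sum.swap) (simp add: sum_distrib_left)
      finally show ?thesis using c by simp
    qed
    have "c j = (\<Sum>s<r. if j = s then c s else 0)" using j by simp
    also have "\<dots> = (\<Sum>s<r. (\<Sum>i<r. Q j i * P i s) * c s)"
      by (intro sum.cong refl) (use square_inverse_swap[of r P Q, OF PQ] j in auto)
    also have "\<dots> = (\<Sum>s<r. \<Sum>i<r. Q j i * (P i s * c s))"
      by (simp add: sum_distrib_right mult.assoc)
    also have "\<dots> = (\<Sum>i<r. Q j i * (\<Sum>s<r. P i s * c s))"
      by (subst sum.swap) (simp add: sum_distrib_left)
    finally show "c j = 0" by (simp add: Pc)
  qed
qed

lemma inj_on_imp_permutes:
  fixes \<pi>0 :: "nat \<Rightarrow> nat"
  assumes "inj_on \<pi>0 {..<r}" "\<And>i. i < r \<Longrightarrow> \<pi>0 i < r"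
  obtains \<pi> where "\<pi> permutes {..<r}" "\<And>i. i < r \<Longrightarrow> \<pi> i = \<pi>0 i"
proof
  let ?\<pi> = "\<lambda>i. if i < r then \<pi>0 i else i"
  have "bij_betw \<pi>0 {..<r} {..<r}"
    using assms endo_inj_surj[of "{..<r}" \<pi>0] by (auto simp: bij_betw_def)
  then have "bij_betw ?\<pi> {..<r} {..<r}"
    by (rule bij_betw_cong[THEN iffD1, rotated]) simp
  then show "?\<pi> permutes {..<r}"
    by (rule bij_imp_permutes) simp
qed simp

text \<open>
  All minimization problems of the algorithm are consistent: the true decomposition attains residual
  zero. Being the minimizer then means being the only solution of a system of equations.
\<close>

lemma the_minimizer_iff_unique_zero:
  assumes "\<And>y. 0 \<le> f y" "x0 \<in> S" "f x0 = 0"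
  shows "the_minimizer f S x \<longleftrightarrow> x \<in> S \<and> f x = 0 \<and> (\<forall>y\<in>S. f y = 0 \<longrightarrow> y = x)"
proof -
  have "is_arg_min f (\<lambda>y. y \<in> S) y \<longleftrightarrow> y \<in> S \<and> f y = 0" for y
    using assms by (auto simp: is_arg_min_def not_less) (metis antisym)
  then show ?thesis unfolding the_minimizer_def by auto
qed

lemma powr_root_power:
  fixes c :: complex
  assumes "c \<noteq> 0" "1 \<le> m"
  shows "(c powr (1 / of_nat m)) ^ m = c"
  using assms by (simp add: powr_def flip: exp_of_nat_mult)

section \<open>Monomials and entries of tensors\<close>

lemma mono_eval_add [simp]: "mono_eval (\<alpha> + \<beta>) u = mono_eval \<alpha> u * mono_eval \<beta> u"
  by (simp add: mono_eval_def)

lemma mono_eval_add_mset [simp]: "mono_eval (add_mset l \<alpha>) u = u l * mono_eval \<alpha> u"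
  by (simp add: mono_eval_def)

lemma mono_eval_replicate [simp]: "mono_eval (replicate_mset d l) u = u l ^ d"
  by (simp add: mono_eval_def)

lemma mono_eval_cong: "(\<And>l. l \<in># \<alpha> \<Longrightarrow> u l = w l) \<Longrightarrow> mono_eval \<alpha> u = mono_eval \<alpha> w"
  unfolding mono_eval_def by (intro arg_cong[of _ _ prod_mset] image_mset_cong)

lemma mono_eval_scale: "mono_eval \<alpha> (\<lambda>l. c * u l) = c ^ size \<alpha> * mono_eval \<alpha> u"
  by (induction \<alpha>) (auto simp: mono_eval_def)

lemma mono_eval_down: "mono_eval (down k \<gamma>) w = mono_eval \<gamma> (\<lambda>l. w (l - k))"
  by (simp add: mono_eval_def down_def image_mset.compositionality comp_def)

lemma tensor_power_eq_mono_eval: "tensor_power q is = mono_eval (mset is) q"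
  unfolding tensor_power_def mono_eval_def
  by (metis mset_map prod_mset_prod_list)

lemma tensor_power_scale: "tensor_power (\<lambda>l. c * q l) is = c ^ length is * tensor_power q is"
  by (simp add: tensor_power_eq_mono_eval mono_eval_scale)

lemma tensor_power_cong:
  "is \<in> tuples m n \<Longrightarrow> (\<And>l. l \<le> n \<Longrightarrow> q l = q' l) \<Longrightarrow> tensor_power q is = tensor_power q' is"
  unfolding tensor_power_eq_mono_eval
  by (rule mono_eval_cong) (auto simp: tuples_def)

text \<open>
  The index tuple at which \<open>entry\<close> reads the tensor.
\<close>

definition padded :: "nat \<Rightarrow> mono \<Rightarrow> nat list" where
  "padded m \<alpha> = sorted_list_of_multiset (replicate_mset (m - size \<alpha>) 0 + \<alpha>)"

lemma entry_eq_padded: "entry m F \<alpha> = F (padded m \<alpha>)"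
  by (simp add: entry_def padded_def)

lemma mset_padded: "mset (padded m \<alpha>) = replicate_mset (m - size \<alpha>) 0 + \<alpha>"
  by (simp add: padded_def)

lemma padded_in_tuples:
  assumes "set_mset \<alpha> \<subseteq> {0..n}" "size \<alpha> \<le> m"
  shows "padded m \<alpha> \<in> tuples m n"
proof -
  have "length (padded m \<alpha>) = m"
    using arg_cong[OF mset_padded[of m \<alpha>], of size] assms(2) by simp
  moreover have "set (padded m \<alpha>) \<subseteq> {0..n}"
    using arg_cong[OF mset_padded[of m \<alpha>], of set_mset] assms(1) by (auto split: if_splits)
  ultimately show ?thesis by (simp add: tuples_def)
qed

text \<open>
  The tuple may contain the index \<open>0\<close> once, so the input subtensor shows the squarefree entries of
  degree \<open>m - 1\<close> as well as those of degree \<open>m\<close>.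
\<close>

lemma padded_in_Omega:
  assumes "set_mset \<alpha> \<subseteq> {1..n}" "size \<alpha> \<le> m" "m \<le> Suc (size \<alpha>)" "\<And>x. count \<alpha> x \<le> 1"
  shows "padded m \<alpha> \<in> Omega m n"
proof -
  have "count \<alpha> 0 = 0" using assms(1) by (auto simp: count_eq_zero_iff)
  then have le: "count (mset (padded m \<alpha>)) x \<le> 1" for x
    using assms(2,3) assms(4)[of x] by (cases "x = 0") (auto simp: mset_padded)
  have "distinct (padded m \<alpha>)"
    unfolding distinct_count_atmost_1
  proof
    fix a
    show "count (mset (padded m \<alpha>)) a = (if a \<in> set (padded m \<alpha>) then 1 else 0)"
      using le[of a] count_mset_0_iff[of "padded m \<alpha>" a]
      by (metis One_nat_def le_Suc_eq le_zero_eq)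
  qed
  then show ?thesis
    using padded_in_tuples[of \<alpha> n m] assms(1,2) by (force simp: Omega_def)
qed

lemma tensor_power_padded: "tensor_power q (padded m \<alpha>) = q 0 ^ (m - size \<alpha>) * mono_eval \<alpha> q"
  by (simp add: tensor_power_eq_mono_eval mset_padded)

lemma tensor_power_hom1_padded:
  assumes "set_mset \<alpha> \<subseteq> {1..n}"
  shows "tensor_power (hom1 u) (padded m \<alpha>) = mono_eval \<alpha> u"
proof -
  have "mono_eval \<alpha> (hom1 u) = mono_eval \<alpha> u"
    by (rule mono_eval_cong) (use assms in \<open>auto simp: hom1_def\<close>)
  then show ?thesis by (simp add: tensor_power_padded) (simp add: hom1_def)
qed

lemma finite_Omega: "finite (Omega m n)"
proof -
  have "Omega m n \<subseteq> {xs. set xs \<subseteq> {0..n} \<and> length xs = m}"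
    by (auto simp: Omega_def tuples_def)
  then show ?thesis by (rule finite_subset) (simp add: finite_lists_length_eq)
qed

lemma finite_sqfree_monos: "finite S \<Longrightarrow> finite (sqfree_monos S d)"
  by (rule finite_subset[of _ "mset_set ` Pow S"]) (auto simp: sqfree_monos_def)

lemma sqfree_monosD:
  assumes "\<alpha> \<in> sqfree_monos S d" "finite S"
  shows "set_mset \<alpha> \<subseteq> S" "size \<alpha> = d" "count \<alpha> x \<le> 1"
proof -
  from assms obtain I where "\<alpha> = mset_set I" "I \<subseteq> S" "card I = d" "finite I"
    by (auto simp: sqfree_monos_def intro: finite_subset)
  then show "set_mset \<alpha> \<subseteq> S" "size \<alpha> = d" "count \<alpha> x \<le> 1"
    by (auto simp: count_mset_set')
qed

lemma card_sqfree_monos: "finite S \<Longrightarrow> card (sqfree_monos S d) = card S choose d"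
proof -
  assume S: "finite S"
  have "sqfree_monos S d = mset_set ` {I. I \<subseteq> S \<and> card I = d}"
    by (auto simp: sqfree_monos_def)
  moreover have "inj_on mset_set {I. I \<subseteq> S \<and> card I = d}"
    using S by (intro inj_onI) (metis (no_types, lifting) finite_set_mset_mset_set finite_subset mem_Collect_eq)
  ultimately show ?thesis by (simp add: card_image n_subsets S)
qed

lemma finite_J1: "finite (J1 k p)" by (simp add: J1_def finite_sqfree_monos)
lemma finite_J2: "finite (J2 m n k p)" by (simp add: J2_def finite_sqfree_monos)

lemma B0_list:
  assumes "r \<le> k choose p"
  shows "length (B0_list k p r) = r" "distinct (B0_list k p r)"
proof -
  let ?L = "sorted_list_of_multiset ` J1 k p"
  have inj: "inj sorted_list_of_multiset"
    by (metis injI mset_sorted_list_of_multiset)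
  have "card ?L = card (J1 k p)"
    by (rule card_image[OF inj_on_subset[OF inj subset_UNIV]])
  then have "card ?L = k choose p"
    by (simp add: J1_def card_sqfree_monos)
  with assms show "length (B0_list k p r) = r"
    by (simp add: B0_list_def finite_J1)
  have "inj_on mset ?L" by (auto simp: inj_on_def)
  then show "distinct (B0_list k p r)"
    by (simp add: B0_list_def distinct_map finite_J1)
qed

lemma B0_subset_J1: "B0 k p r \<subseteq> J1 k p"
proof -
  have "set (map mset (sorted_list_of_set (sorted_list_of_multiset ` J1 k p))) = J1 k p"
    by (simp add: finite_J1 image_image)
  then show ?thesis unfolding B0_def B0_list_def by (metis set_take_subset)
qed

lemma finite_B0: "finite (B0 k p r)" by (simp add: B0_def)

lemma O_set_subset_J2: "O_set m n k p \<alpha> \<subseteq> J2 m n k p"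
  by (auto simp: O_set_def J2_def sqfree_monos_def)

lemma finite_O_set: "finite (O_set m n k p \<alpha>)"
  by (simp add: O_set_def finite_sqfree_monos)

text \<open>
  This turns an arbitrary decomposition into one of the form assumed for \<open>F\<close>, with weights \<open>(q\<^sub>i)\<^sub>0\<^sup>m\<close>.
\<close>

lemma tensor_power_dehomogenize:
  assumes "q 0 \<noteq> 0" "length is = m"
  shows "tensor_power q is = q 0 ^ m * tensor_power (hom1 (\<lambda>l. q l / q 0)) is"
proof -
  have "q = (\<lambda>l. q 0 * hom1 (\<lambda>l. q l / q 0) l)" using assms(1) by (auto simp: hom1_def)
  then have "tensor_power q is = tensor_power (\<lambda>l. q 0 * hom1 (\<lambda>l. q l / q 0) l) is" by simp
  then show ?thesis using assms(2) by (simp add: tensor_power_scale)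
qed

lemma entry_eq_sum:
  assumes "tensor_eq m n F (\<lambda>is. \<Sum>i<r. lam i * tensor_power (hom1 (u i)) is)"
    and \<alpha>: "set_mset \<alpha> \<subseteq> {1..n}" "size \<alpha> \<le> m"
  shows "entry m F \<alpha> = (\<Sum>i<r. lam i * mono_eval \<alpha> (u i))"
proof -
  have "set_mset \<alpha> \<subseteq> {0..n}" using \<alpha>(1) by auto
  with \<alpha>(2) have "padded m \<alpha> \<in> tuples m n" by (simp add: padded_in_tuples)
  with assms(1) have "entry m F \<alpha> = (\<Sum>i<r. lam i * tensor_power (hom1 (u i)) (padded m \<alpha>))"
    by (simp add: tensor_eq_def entry_eq_padded)
  then show ?thesis by (simp only: tensor_power_hom1_padded[OF \<alpha>(1)])
qed

section \<open>The eigenvectors of \<open>N(\<xi>)\<close>\<close>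

text \<open>
  The setting of one decomposition of \<open>F\<close>. It is a locale because the same arguments are applied to
  several decompositions of the same \<open>F\<close>: the given one, its permutations, and the rescaling of any
  competing one.
\<close>

locale generic_decomposition =
  fixes m n k p r :: nat and F :: tensor
    and lam :: "nat \<Rightarrow> complex" and u :: "nat \<Rightarrow> nat \<Rightarrow> complex"
  assumes p_le_m: "p + 2 \<le> m" and p_le_k: "p \<le> k"
    and k_bound: "k + m \<le> n + p"
    and r_le: "r \<le> k choose p"
    and lam_nz: "i < r \<Longrightarrow> lam i \<noteq> 0"
    and F_eq: "tensor_eq m n F (\<lambda>is. \<Sum>i<r. lam i * tensor_power (hom1 (u i)) is)"
    and indep_B0: "indep r (\<lambda>i \<beta>. mono_eval \<beta> (u i)) (B0 k p r)"
    and indep_O: "\<alpha> \<in> B1 n k p \<Longrightarrow> indep r (\<lambda>i \<gamma>. mono_eval \<gamma> (u i)) (O_set m n k p \<alpha>)"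
begin

abbreviation T :: tensor where "T \<equiv> restrict F (Omega m n)"

lemma k_lt_n: "k < n"
  using p_le_m k_bound by linarith

lemma J1D:
  assumes "\<beta> \<in> J1 k p"
  shows "set_mset \<beta> \<subseteq> {1..k}" "size \<beta> = p" "count \<beta> x \<le> 1"
  using assms sqfree_monosD[of \<beta> "{1..k}" p] by (simp_all add: J1_def)

lemma J2D:
  assumes "\<gamma> \<in> J2 m n k p"
  shows "set_mset \<gamma> \<subseteq> {k+1..n}" "size \<gamma> = m - p - 1" "count \<gamma> x \<le> 1"
  using assms sqfree_monosD[of \<gamma> "{k+1..n}" "m - p - 1"] by (simp_all add: J2_def)

lemma B0D: "\<beta> \<in> B0 k p r \<Longrightarrow> \<beta> \<in> J1 k p"
  using B0_subset_J1 by blast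

text \<open>
  Each \<open>\<O>\<^sub>\<alpha>\<close> is contained in \<open>J\<^sub>2\<close>; it remains to exhibit some \<open>\<alpha> \<in> \<B>\<^sub>1\<close>.
\<close>

lemma indep_J2: "indep r (\<lambda>i \<gamma>. mono_eval \<gamma> (u i)) (J2 m n k p)"
proof -
  have "mset_set {1..p} \<in> J1 k p"
    using p_le_k by (auto simp: J1_def sqfree_monos_def)
  then have "mset_set {1..p} + {#n#} \<in> B1 n k p"
    using k_lt_n unfolding B1_def mem_Collect_eq
    by (intro exI[of _ "mset_set {1..p}"] exI[of _ n]) auto
  from indep_O[OF this] O_set_subset_J2 show ?thesis by (rule indep_mono)
qed

lemma indep_lam_J2: "indep r (\<lambda>i \<gamma>. lam i * mono_eval \<gamma> (u i)) (J2 m n k p)"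
  using indep_J2 lam_nz by (rule indep_scale)

lemmas entry_F = entry_eq_sum[OF F_eq]

lemma entry_T:
  assumes "set_mset \<alpha> \<subseteq> {1..n}" "size \<alpha> \<le> m" "m \<le> Suc (size \<alpha>)" "\<And>x. count \<alpha> x \<le> 1"
  shows "entry m T \<alpha> = (\<Sum>i<r. lam i * mono_eval \<alpha> (u i))"
proof -
  have "entry m T \<alpha> = entry m F \<alpha>"
    using padded_in_Omega[OF assms] by (simp add: entry_eq_padded)
  also have "\<dots> = (\<Sum>i<r. lam i * mono_eval \<alpha> (u i))"
    using assms(1,2) by (rule entry_F)
  finally show ?thesis .
qed

lemma J1_J2_monos:
  assumes "\<beta> \<in> J1 k p" "\<gamma> \<in> J2 m n k p"
  shows "set_mset (\<beta> + \<gamma>) \<subseteq> {1..n}" "size (\<beta> + \<gamma>) = m - 1" "count (\<beta> + \<gamma>) x \<le> 1"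
proof -
  note b = J1D[OF assms(1)] and c = J2D[OF assms(2)]
  show "set_mset (\<beta> + \<gamma>) \<subseteq> {1..n}" using b(1) c(1) k_lt_n by fastforce
  show "size (\<beta> + \<gamma>) = m - 1" using b(2) c(2) p_le_m by simp
  have "x \<notin># \<beta> \<or> x \<notin># \<gamma>" using b(1) c(1) by fastforce
  then show "count (\<beta> + \<gamma>) x \<le> 1" using b(3)[of x] c(3)[of x] by (auto simp: not_in_iff)
qed

lemma entry_T_J1_J2:
  assumes "\<beta> \<in> J1 k p" "\<gamma> \<in> J2 m n k p"
  shows "entry m T (\<beta> + \<gamma>) = (\<Sum>i<r. mono_eval \<beta> (u i) * (lam i * mono_eval \<gamma> (u i)))"
  using J1_J2_monos[OF assms] by (subst entry_T) (auto simp: mult_ac)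

lemma entry_F_extra:
  assumes "\<beta> \<in> J1 k p" "\<gamma> \<in> J2 m n k p" "l \<in> {1..n}"
  shows "entry m F ({#l#} + \<beta> + \<gamma>)
    = (\<Sum>i<r. u i l * mono_eval \<beta> (u i) * (lam i * mono_eval \<gamma> (u i)))"
proof -
  have "set_mset ({#l#} + \<beta> + \<gamma>) \<subseteq> {1..n}" "size ({#l#} + \<beta> + \<gamma>) \<le> m"
    using J1_J2_monos[OF assms(1,2)] assms(3) p_le_m by auto
  then show ?thesis by (subst entry_F) (auto simp: mult_ac)
qed

lemma entry_T_extra:
  assumes "\<beta> \<in> J1 k p" "\<gamma> \<in> J2 m n k p" "l \<in> {1..n}" "l \<notin># \<beta>" "l \<notin># \<gamma>"
  shows "entry m T ({#l#} + \<beta> + \<gamma>)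
    = (\<Sum>i<r. u i l * mono_eval \<beta> (u i) * (lam i * mono_eval \<gamma> (u i)))"
proof -
  note J = J1_J2_monos[OF assms(1,2)]
  have "set_mset ({#l#} + \<beta> + \<gamma>) \<subseteq> {1..n}" "size ({#l#} + \<beta> + \<gamma>) = m"
    using J assms(3) p_le_m by auto
  moreover have "count ({#l#} + \<beta> + \<gamma>) x \<le> 1" for x
    using J(3)[of x] assms(4,5) by (auto simp: not_in_iff)
  ultimately show ?thesis by (subst entry_T) (auto simp: mult_ac)
qed

text \<open>
  The equation for \<open>\<gamma>\<close> compares two combinations of the values \<open>\<lambda>\<^sub>i x\<^sup>\<gamma>(u\<^sub>i)\<close>. The left-hand
  coefficients are the values of \<open>\<Sum>\<^sub>\<beta> G(\<beta>,\<alpha>) x\<^sup>\<beta>\<close> at the \<open>u\<^sub>i\<close>, the right-hand ones those of \<open>x\<^sup>\<alpha>\<close>, and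
  independence on \<open>\<O>\<^sub>\<alpha>\<close> lets us compare them. Since \<open>\<gamma>\<close> avoids \<open>j\<^bsub>p+1\<^esub>\<close>, the monomial \<open>x\<^sup>\<alpha> x\<^sup>\<gamma>\<close> is
  squarefree and its entry is part of the input.
\<close>

lemma step1_iff_interpolation:
  "step1 m n k p r T G \<longleftrightarrow>
     (\<forall>\<alpha>\<in>B1 n k p. \<forall>i<r. (\<Sum>\<beta>\<in>B0 k p r. mono_eval \<beta> (u i) * G \<beta> \<alpha>) = mono_eval \<alpha> (u i))"
proof -
  have "(\<forall>\<gamma>\<in>O_set m n k p \<alpha>. (\<Sum>\<beta>\<in>B0 k p r. A_entry m T \<gamma> \<beta> * G \<beta> \<alpha>) = b_entry m T \<alpha> \<gamma>)
      \<longleftrightarrow> (\<forall>i<r. (\<Sum>\<beta>\<in>B0 k p r. mono_eval \<beta> (u i) * G \<beta> \<alpha>) = mono_eval \<alpha> (u i))"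
    if \<alpha>: "\<alpha> \<in> B1 n k p" for \<alpha>
  proof -
    obtain \<beta>0 l where \<beta>0: "\<alpha> = \<beta>0 + {#l#}" "\<beta>0 \<in> J1 k p" "l \<in> {k+1..n}"
      using \<alpha> by (auto simp: B1_def)
    define h where "h i = (\<Sum>\<beta>\<in>B0 k p r. mono_eval \<beta> (u i) * G \<beta> \<alpha>)" for i
    have A: "(\<Sum>\<beta>\<in>B0 k p r. A_entry m T \<gamma> \<beta> * G \<beta> \<alpha>)
        = (\<Sum>i<r. h i * (lam i * mono_eval \<gamma> (u i)))" if "\<gamma> \<in> O_set m n k p \<alpha>" for \<gamma>
    proof -
      have "\<gamma> \<in> J2 m n k p" using that O_set_subset_J2 by blast
      then have "(\<Sum>\<beta>\<in>B0 k p r. A_entry m T \<gamma> \<beta> * G \<beta> \<alpha>)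
        = (\<Sum>\<beta>\<in>B0 k p r. \<Sum>i<r. mono_eval \<beta> (u i) * G \<beta> \<alpha> * (lam i * mono_eval \<gamma> (u i)))"
        by (intro sum.cong refl)
          (simp add: A_entry_def entry_T_J1_J2[OF B0D] sum_distrib_left sum_distrib_right mult_ac)
      also have "\<dots> = (\<Sum>i<r. h i * (lam i * mono_eval \<gamma> (u i)))"
        by (subst sum.swap) (simp add: h_def sum_distrib_right)
      finally show ?thesis .
    qed
    have b: "b_entry m T \<alpha> \<gamma> = (\<Sum>i<r. mono_eval \<alpha> (u i) * (lam i * mono_eval \<gamma> (u i)))"
      if "\<gamma> \<in> O_set m n k p \<alpha>" for \<gamma>
    proof -
      have g: "\<gamma> \<in> J2 m n k p" using that O_set_subset_J2 by blast
      have "set_mset \<gamma> \<subseteq> {k+1..n} - set_mset \<alpha>"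
        using that unfolding O_set_def by (rule sqfree_monosD) simp
      then have "l \<notin># \<gamma>" using \<beta>0(1) by auto
      moreover have "l \<notin># \<beta>0" using J1D(1)[OF \<beta>0(2)] \<beta>0(3) by auto
      moreover have "l \<in> {1..n}" using \<beta>0(3) by auto
      ultimately have "entry m T ({#l#} + \<beta>0 + \<gamma>)
          = (\<Sum>i<r. u i l * mono_eval \<beta>0 (u i) * (lam i * mono_eval \<gamma> (u i)))"
        using \<beta>0(2) g by (intro entry_T_extra)
      then show ?thesis by (simp add: b_entry_def \<beta>0(1) mult_ac)
    qed
    have ind: "indep r (\<lambda>i \<gamma>. lam i * mono_eval \<gamma> (u i)) (O_set m n k p \<alpha>)"
      using indep_O[OF \<alpha>] lam_nz by (rule indep_scale)
    show ?thesis
      unfolding h_def[symmetric]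
    proof
      assume L: "\<forall>\<gamma>\<in>O_set m n k p \<alpha>.
        (\<Sum>\<beta>\<in>B0 k p r. A_entry m T \<gamma> \<beta> * G \<beta> \<alpha>) = b_entry m T \<alpha> \<gamma>"
      show "\<forall>i<r. h i = mono_eval \<alpha> (u i)"
      proof (intro allI impI)
        fix i assume i: "i < r"
        show "h i = mono_eval \<alpha> (u i)"
        proof (rule indep_eqD[OF ind _ i])
          fix \<gamma> assume g: "\<gamma> \<in> O_set m n k p \<alpha>"
          show "(\<Sum>i<r. h i * (lam i * mono_eval \<gamma> (u i)))
              = (\<Sum>i<r. mono_eval \<alpha> (u i) * (lam i * mono_eval \<gamma> (u i)))"
            using L g A[OF g] b[OF g] by metis
        qed
      qed
    next
      assume R: "\<forall>i<r. h i = mono_eval \<alpha> (u i)"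
      show "\<forall>\<gamma>\<in>O_set m n k p \<alpha>.
        (\<Sum>\<beta>\<in>B0 k p r. A_entry m T \<gamma> \<beta> * G \<beta> \<alpha>) = b_entry m T \<alpha> \<gamma>"
      proof
        fix \<gamma> assume g: "\<gamma> \<in> O_set m n k p \<alpha>"
        show "(\<Sum>\<beta>\<in>B0 k p r. A_entry m T \<gamma> \<beta> * G \<beta> \<alpha>) = b_entry m T \<alpha> \<gamma>"
          unfolding A[OF g] b[OF g] by (intro sum.cong refl) (use R in auto)
      qed
    qed
  qed
  then show ?thesis by (auto simp: step1_def)
qed

text \<open>
  Dual functionals solve the interpolation problem explicitly (Lagrange interpolation).
\<close>

lemma ex_step1: "\<exists>G. step1 m n k p r T G"
proof -
  obtain d where d: "\<And>i j. i < r \<Longrightarrow> j < r \<Longrightarrow>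
      (\<Sum>\<beta>\<in>B0 k p r. d i \<beta> * mono_eval \<beta> (u j)) = (if i = j then 1 else 0)"
    using indep_dual[OF finite_B0 indep_B0] by blast
  define G where "G \<beta> \<alpha> = (\<Sum>i<r. d i \<beta> * mono_eval \<alpha> (u i))" for \<beta> \<alpha>
  have "(\<Sum>\<beta>\<in>B0 k p r. mono_eval \<beta> (u j) * G \<beta> \<alpha>) = mono_eval \<alpha> (u j)" if "j < r" for j \<alpha>
  proof -
    have "(\<Sum>\<beta>\<in>B0 k p r. mono_eval \<beta> (u j) * G \<beta> \<alpha>)
        = (\<Sum>i<r. mono_eval \<alpha> (u i) * (\<Sum>\<beta>\<in>B0 k p r. d i \<beta> * mono_eval \<beta> (u j)))"
      unfolding G_def sum_distrib_left by (subst sum.swap) (simp add: mult_ac)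
    also have "\<dots> = (\<Sum>i<r. if i = j then mono_eval \<alpha> (u i) else 0)"
      by (intro sum.cong refl) (use that d in auto)
    finally show ?thesis using that by simp
  qed
  then show ?thesis unfolding step1_iff_interpolation by blast
qed

text \<open>
  The vector \<open>[u\<^sub>i]\<^bsub>\<B>\<^sub>0\<^esub>\<close>, numbered like the rows of \<open>N\<^sub>l(G)\<close>.
\<close>

definition B0_vec :: "nat \<Rightarrow> complex Matrix.vec" where
  "B0_vec i = Matrix.vec r (\<lambda>a. mono_eval (B0_list k p r ! a) (u i))"

definition theta :: "(nat \<Rightarrow> complex) \<Rightarrow> nat \<Rightarrow> complex" where
  "theta \<xi> i = (\<Sum>l = k+1..n. \<xi> l * u i l)"

lemma B0_vec_carrier [simp]: "B0_vec i \<in> carrier_vec r"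
  by (simp add: B0_vec_def)

lemma dim_B0_vec [simp]: "dim_vec (B0_vec i) = r"
  by (simp add: B0_vec_def)

lemma B0_nth: "a < r \<Longrightarrow> B0_list k p r ! a \<in> B0 k p r"
  using B0_list[OF r_le] by (simp add: B0_def)

lemma sum_B0: "(\<Sum>\<beta>\<in>B0 k p r. f \<beta>) = (\<Sum>a<r. f (B0_list k p r ! a))"
  using sum.reindex_bij_betw[OF bij_betw_nth[OF B0_list(2)[OF r_le] refl refl], of f] B0_list(1)[OF r_le]
  by (simp add: B0_def)

lemma indep_B0_vec: "indep r (\<lambda>i a. B0_vec i $ a) {..<r}"
  unfolding indep_def
proof (intro allI impI)
  fix c i assume c: "\<forall>a\<in>{..<r}. (\<Sum>i<r. c i * B0_vec i $ a) = 0" and i: "i < r"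
  show "c i = 0"
  proof (rule indepD[OF indep_B0 _ i])
    fix \<beta> assume "\<beta> \<in> B0 k p r"
    then obtain a where "a < r" "\<beta> = B0_list k p r ! a"
      using B0_list(1)[OF r_le] by (auto simp: B0_def in_set_conv_nth)
    with c show "(\<Sum>i<r. c i * mono_eval \<beta> (u i)) = 0" by (simp add: B0_vec_def)
  qed
qed

lemma B0_vec_nonzero:
  assumes "i < r"
  obtains a where "a < r" "B0_vec i $ a \<noteq> 0"
  using indep_nonzero[OF indep_B0_vec assms] by auto

text \<open>
  There are \<open>r\<close> coordinates, so the matrix of dual functionals is a left inverse of a square matrix and
  hence also a right inverse; that is the expansion of \<open>z\<close>.
\<close>

lemma B0_vec_span:
  assumes "z \<in> carrier_vec r"
  obtains x where "\<And>a. a < r \<Longrightarrow> z $ a = (\<Sum>i<r. x i * B0_vec i $ a)"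
proof -
  obtain d where d: "\<And>i j. i < r \<Longrightarrow> j < r \<Longrightarrow>
      (\<Sum>a\<in>{..<r}. d i a * B0_vec j $ a) = (if i = j then 1 else 0)"
    using indep_dual[OF finite_lessThan indep_B0_vec] by blast
  have swap: "(\<Sum>i<r. B0_vec i $ a * d i b) = (if a = b then 1 else 0)" if "a < r" "b < r" for a b
    using square_inverse_swap[of r d "\<lambda>a i. B0_vec i $ a", OF d that] .
  have "z $ a = (\<Sum>i<r. (\<Sum>b<r. d i b * z $ b) * B0_vec i $ a)" if "a < r" for a
  proof -
    have "(\<Sum>i<r. (\<Sum>b<r. d i b * z $ b) * B0_vec i $ a)
        = (\<Sum>b<r. (\<Sum>i<r. B0_vec i $ a * d i b) * z $ b)"
      unfolding sum_distrib_right by (subst sum.swap) (simp add: mult_ac)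
    also have "\<dots> = (\<Sum>b<r. if b = a then z $ b else 0)"
      by (intro sum.cong refl) (use swap that in auto)
    finally show ?thesis using that by simp
  qed
  then show thesis by (rule that)
qed

lemma N_mat_carrier [simp]: "N_mat k p r G l \<in> carrier_mat r r"
  by (simp add: N_mat_def)

lemma N_xi_carrier [simp]: "N_xi n k p r G \<xi> \<in> carrier_mat r r"
  by (simp add: N_xi_def)

lemma dim_N [simp]:
  "dim_row (N_mat k p r G l) = r" "dim_row (N_xi n k p r G \<xi>) = r"
  by (simp_all add: N_mat_def N_xi_def)

lemma mult_vec_index:
  assumes "M \<in> carrier_mat r r" "z \<in> carrier_vec r" "a < r"
  shows "(M *\<^sub>v z) $ a = (\<Sum>b<r. M $$ (a, b) * z $ b)"
  using assms by (simp add: scalar_prod_def atLeast0LessThan)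

text \<open>
  Row \<open>\<nu>\<close> of this equation is the interpolation property at \<open>u\<^sub>i\<close> for \<open>\<alpha> = \<nu> + e\<^sub>l\<close>.
\<close>

lemma N_mat_B0_vec:
  assumes G: "step1 m n k p r T G" and l: "l \<in> {k+1..n}" and i: "i < r"
  shows "N_mat k p r G l *\<^sub>v B0_vec i = u i l \<cdot>\<^sub>v B0_vec i"
proof (rule eq_vecI)
  fix a assume "a < dim_vec (u i l \<cdot>\<^sub>v B0_vec i)"
  then have a: "a < r" by (simp add: B0_vec_def)
  let ?\<alpha> = "B0_list k p r ! a + {#l#}"
  have "?\<alpha> \<in> B1 n k p"
    using B0D[OF B0_nth[OF a]] l by (auto simp: B1_def)
  then have "(\<Sum>\<beta>\<in>B0 k p r. mono_eval \<beta> (u i) * G \<beta> ?\<alpha>) = mono_eval ?\<alpha> (u i)"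
    using G i unfolding step1_iff_interpolation by blast
  then show "(N_mat k p r G l *\<^sub>v B0_vec i) $ a = (u i l \<cdot>\<^sub>v B0_vec i) $ a"
    using a by (simp add: mult_vec_index[OF N_mat_carrier B0_vec_carrier] sum_B0 del: index_mult_mat_vec)
      (simp add: N_mat_def B0_vec_def mult_ac)
qed (simp add: B0_vec_def N_mat_def)

lemma N_xi_mult:
  assumes "z \<in> carrier_vec r" "a < r"
  shows "(N_xi n k p r G \<xi> *\<^sub>v z) $ a = (\<Sum>l = k+1..n. \<xi> l * (N_mat k p r G l *\<^sub>v z) $ a)"
proof -
  have "(N_xi n k p r G \<xi> *\<^sub>v z) $ a
      = (\<Sum>b<r. \<Sum>l = k+1..n. \<xi> l * (N_mat k p r G l $$ (a, b) * z $ b))"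
    unfolding mult_vec_index[OF N_xi_carrier assms]
    using assms(2) by (simp add: N_xi_def sum_distrib_right mult.assoc)
  also have "\<dots> = (\<Sum>l = k+1..n. \<xi> l * (N_mat k p r G l *\<^sub>v z) $ a)"
    unfolding mult_vec_index[OF N_mat_carrier assms]
    by (subst sum.swap) (simp add: sum_distrib_left)
  finally show ?thesis .
qed

lemma N_xi_B0_vec:
  assumes "step1 m n k p r T G" "i < r" "a < r"
  shows "(N_xi n k p r G \<xi> *\<^sub>v B0_vec i) $ a = theta \<xi> i * B0_vec i $ a"
proof -
  have "(N_xi n k p r G \<xi> *\<^sub>v B0_vec i) $ a = (\<Sum>l = k+1..n. \<xi> l * (u i l * B0_vec i $ a))"
    unfolding N_xi_mult[OF B0_vec_carrier assms(3)]
    by (intro sum.cong refl arg_cong2[of _ _ _ _ "(*)"])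
      (use assms N_mat_B0_vec[OF assms(1) _ assms(2)] in auto)
  then show ?thesis by (simp add: theta_def sum_distrib_right mult.assoc)
qed

lemma eigenvector_B0_vec:
  assumes "step1 m n k p r T G" "i < r"
  shows "eigenvector (N_xi n k p r G \<xi>) (B0_vec i) (theta \<xi> i)"
proof -
  have "B0_vec i \<noteq> 0\<^sub>v r" using B0_vec_nonzero[OF assms(2)] by (metis index_zero_vec(1))
  moreover have "N_xi n k p r G \<xi> *\<^sub>v B0_vec i = theta \<xi> i \<cdot>\<^sub>v B0_vec i"
    by (rule eq_vecI) (use assms in \<open>auto simp: N_xi_B0_vec simp del: index_mult_mat_vec\<close>)
  ultimately show ?thesis by (simp add: eigenvector_def)
qed

text \<open>
  Compare coefficients of the independent vectors \<open>[u\<^sub>i]\<^bsub>\<B>\<^sub>0\<^esub>\<close> in \<open>N(\<xi>) z = \<mu> z\<close>.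
\<close>

lemma eigenvalue_coord:
  assumes G: "step1 m n k p r T G" and z: "eigenvector (N_xi n k p r G \<xi>) z \<mu>"
    and x: "\<And>a. a < r \<Longrightarrow> z $ a = (\<Sum>i<r. x i * B0_vec i $ a)" and i: "i < r"
  shows "x i = 0 \<or> theta \<xi> i = \<mu>"
proof -
  let ?N = "N_xi n k p r G \<xi>"
  from z have zc: "z \<in> carrier_vec r" and Nz: "?N *\<^sub>v z = \<mu> \<cdot>\<^sub>v z"
    by (auto simp: eigenvector_def)
  have "(\<Sum>i<r. (x i * theta \<xi> i) * B0_vec i $ a) = (\<Sum>i<r. (\<mu> * x i) * B0_vec i $ a)" if a: "a < r" for a
  proof -
    have "(\<Sum>i<r. (x i * theta \<xi> i) * B0_vec i $ a) = (\<Sum>i<r. x i * (?N *\<^sub>v B0_vec i) $ a)"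
      by (intro sum.cong refl) (use G a in \<open>simp add: N_xi_B0_vec mult.assoc del: index_mult_mat_vec\<close>)
    also have "\<dots> = (\<Sum>b<r. ?N $$ (a, b) * (\<Sum>i<r. x i * B0_vec i $ b))"
      unfolding mult_vec_index[OF N_xi_carrier B0_vec_carrier a] sum_distrib_left
      by (subst sum.swap) (simp add: mult_ac)
    also have "\<dots> = (?N *\<^sub>v z) $ a"
      unfolding mult_vec_index[OF N_xi_carrier zc a] by (simp add: x)
    also have "\<dots> = \<mu> * z $ a" using Nz zc a by simp
    also have "\<dots> = (\<Sum>i<r. (\<mu> * x i) * B0_vec i $ a)"
      by (simp add: x[OF a] sum_distrib_left mult.assoc)
    finally show ?thesis .
  qed
  then have "x i * theta \<xi> i = \<mu> * x i"
    using i by (intro indep_eqD[OF indep_B0_vec, of "\<lambda>i. x i * theta \<xi> i" "\<lambda>i. \<mu> * x i"]) auto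
  then show ?thesis by auto
qed

lemma eigenvector_cases:
  assumes G: "step1 m n k p r T G" and z: "eigenvector (N_xi n k p r G \<xi>) z \<mu>"
  obtains x i where "\<And>a. a < r \<Longrightarrow> z $ a = (\<Sum>i<r. x i * B0_vec i $ a)" "i < r" "x i \<noteq> 0" "theta \<xi> i = \<mu>"
proof -
  from z have zc: "z \<in> carrier_vec r" and z0: "z \<noteq> 0\<^sub>v r"
    by (auto simp: eigenvector_def)
  obtain x where x: "\<And>a. a < r \<Longrightarrow> z $ a = (\<Sum>i<r. x i * B0_vec i $ a)"
    using B0_vec_span[OF zc] by blast
  have "\<exists>i<r. x i \<noteq> 0"
  proof (rule ccontr)
    assume "\<not> ?thesis"
    then have "z = 0\<^sub>v r" by (intro eq_vecI) (use zc x in auto)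
    with z0 show False by simp
  qed
  then obtain i where "i < r" "x i \<noteq> 0" by blast
  with eigenvalue_coord[OF G z x] x that show thesis by blast
qed

text \<open>
  The \<open>r\<close> distinct eigenvalues all occur among \<open>theta \<xi> 0, \<dots>, theta \<xi> (r - 1)\<close>.
\<close>

lemma inj_on_theta:
  assumes G: "step1 m n k p r T G" and dist: "distinct_eigenvalues (N_xi n k p r G \<xi>)"
  shows "inj_on (theta \<xi>) {..<r}"
proof -
  have "spectrum (N_xi n k p r G \<xi>) \<subseteq> theta \<xi> ` {..<r}"
  proof
    fix \<mu> assume "\<mu> \<in> spectrum (N_xi n k p r G \<xi>)"
    then obtain z where "eigenvector (N_xi n k p r G \<xi>) z \<mu>"
      by (auto simp: spectrum_def eigenvalue_def)
    then show "\<mu> \<in> theta \<xi> ` {..<r}" by (rule eigenvector_cases[OF G]) auto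
  qed
  then have "r \<le> card (theta \<xi> ` {..<r})"
    using dist card_mono[of "theta \<xi> ` {..<r}" "spectrum (N_xi n k p r G \<xi>)"]
    by (simp add: distinct_eigenvalues_def)
  then have "card (theta \<xi> ` {..<r}) = card {..<r}"
    using card_image_le[of "{..<r}" "theta \<xi>"] by simp
  then show ?thesis by (intro eq_card_imp_inj_on) auto
qed

lemma eigenvector_is_multiple_of_B0_vec:
  assumes G: "step1 m n k p r T G" and dist: "distinct_eigenvalues (N_xi n k p r G \<xi>)"
    and z: "eigenvector (N_xi n k p r G \<xi>) z \<mu>"
  obtains x i where "i < r" "x \<noteq> 0" "z = x \<cdot>\<^sub>v B0_vec i" "\<mu> = theta \<xi> i"
proof -
  obtain x i where x: "\<And>a. a < r \<Longrightarrow> z $ a = (\<Sum>i<r. x i * B0_vec i $ a)"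
    and i: "i < r" "x i \<noteq> 0" "theta \<xi> i = \<mu>"
    by (rule eigenvector_cases[OF G z], rule that)
  have "x j = 0" if "j < r" "j \<noteq> i" for j
  proof -
    have "theta \<xi> j \<noteq> theta \<xi> i"
      using inj_onD[OF inj_on_theta[OF G dist], of j i] i(1) that by blast
    with eigenvalue_coord[OF G z x that(1)] i(3) show ?thesis by simp
  qed
  then have z': "z $ a = x i * B0_vec i $ a" if "a < r" for a
    using x[OF that] sum.remove[of "{..<r}" i "\<lambda>i. x i * B0_vec i $ a"] i(1) by simp
  from z have "z \<in> carrier_vec r" by (auto simp: eigenvector_def)
  then have "z = x i \<cdot>\<^sub>v B0_vec i"
    by (intro eq_vecI) (use z' in auto)
  with i that show thesis by blast
qed

section \<open>Recovering the factors and the weights\<close>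

text \<open>
  The eigenvectors come in an arbitrary order. Permuting the decomposition accordingly reduces the
  analysis of the last step to the case in which the order is the given one.
\<close>

lemma permuted:
  assumes \<sigma>: "\<sigma> permutes {..<r}"
  shows "generic_decomposition m n k p r F (\<lambda>i. lam (\<sigma> i)) (\<lambda>i. u (\<sigma> i))"
proof
  show "lam (\<sigma> i) \<noteq> 0" if "i < r" for i
    using permutes_in_image[OF \<sigma>, of i] that lam_nz by simp
  have "(\<Sum>i<r. lam (\<sigma> i) * tensor_power (hom1 (u (\<sigma> i))) is)
      = (\<Sum>i<r. lam i * tensor_power (hom1 (u i)) is)" for "is"
    using sum.permute[OF \<sigma>, of "\<lambda>i. lam i * tensor_power (hom1 (u i)) is"] by (simp add: comp_def)
  with F_eq show "tensor_eq m n F (\<lambda>is. \<Sum>i<r. lam (\<sigma> i) * tensor_power (hom1 (u (\<sigma> i))) is)"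
    by simp
  show "indep r (\<lambda>i \<beta>. mono_eval \<beta> (u (\<sigma> i))) (B0 k p r)"
    using indep_permute[OF indep_B0 \<sigma>] .
  show "indep r (\<lambda>i \<gamma>. mono_eval \<gamma> (u (\<sigma> i))) (O_set m n k p \<alpha>)" if "\<alpha> \<in> B1 n k p" for \<alpha>
    using indep_permute[OF indep_O[OF that] \<sigma>] .
qed (fact p_le_m p_le_k k_bound r_le)+

lemma rayleigh_quotient:
  assumes "step1 m n k p r T G" "s < r" "z = x \<cdot>\<^sub>v B0_vec s" "z \<bullet>c z = 1" "t \<in> {1..n-k}"
  shows "(N_mat k p r G (k + t) *\<^sub>v z) \<bullet>c z = u s (k + t)"
proof -
  have "k + t \<in> {k+1..n}" using assms(5) by auto
  then have "N_mat k p r G (k + t) *\<^sub>v z = x \<cdot>\<^sub>v (u s (k + t) \<cdot>\<^sub>v B0_vec s)"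
    using assms by (simp add: mult_mat_vec[OF N_mat_carrier B0_vec_carrier] N_mat_B0_vec)
  also have "\<dots> = u s (k + t) \<cdot>\<^sub>v z"
    by (simp add: assms(3) smult_smult_assoc mult.commute)
  finally have "N_mat k p r G (k + t) *\<^sub>v z = u s (k + t) \<cdot>\<^sub>v z" .
  moreover have "z \<in> carrier_vec r" by (simp add: assms(3))
  ultimately show ?thesis
    using assms(4) by (simp add: smult_scalar_prod_distrib[of _ r])
qed

lemma step2_recovers_w:
  assumes G: "step1 m n k p r T G" and dist: "distinct_eigenvalues (N_xi n k p r G \<xi>)"
    and w: "step2 n k p r \<xi> G w"
  obtains \<sigma> where "\<sigma> permutes {..<r}"
    "\<And>i t. i < r \<Longrightarrow> t \<in> {1..n-k} \<Longrightarrow> w i t = u (\<sigma> i) (k + t)"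
proof -
  from w obtain z \<mu> where \<mu>: "inj_on \<mu> {..<r}"
    and z: "\<And>i. i < r \<Longrightarrow> eigenvector (N_xi n k p r G \<xi>) (z i) (\<mu> i)"
    and unit: "\<And>i. i < r \<Longrightarrow> z i \<bullet>c z i = 1"
    and wz: "\<And>i t. i < r \<Longrightarrow> t \<in> {1..n-k} \<Longrightarrow> w i t = (N_mat k p r G (k + t) *\<^sub>v z i) \<bullet>c z i"
    unfolding step2_def unit_eigenvectors_def by blast
  have "\<exists>s x. s < r \<and> z i = x \<cdot>\<^sub>v B0_vec s \<and> \<mu> i = theta \<xi> s" if "i < r" for i
    by (rule eigenvector_is_multiple_of_B0_vec[OF G dist z[OF that]]) blast
  then obtain s x where s: "\<And>i. i < r \<Longrightarrow> s i < r" "\<And>i. i < r \<Longrightarrow> z i = x i \<cdot>\<^sub>v B0_vec (s i)"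
      "\<And>i. i < r \<Longrightarrow> \<mu> i = theta \<xi> (s i)"
    by metis
  have "inj_on s {..<r}"
  proof (rule inj_onI)
    fix i j assume ij: "i \<in> {..<r}" "j \<in> {..<r}" "s i = s j"
    then have "\<mu> i = \<mu> j" by (simp add: s(3))
    then show "i = j" using ij(1,2) by (rule inj_onD[OF \<mu>])
  qed
  then obtain \<sigma> where \<sigma>: "\<sigma> permutes {..<r}" "\<And>i. i < r \<Longrightarrow> \<sigma> i = s i"
    using inj_on_imp_permutes s(1) by blast
  have "w i t = u (\<sigma> i) (k + t)" if "i < r" "t \<in> {1..n-k}" for i t
    using rayleigh_quotient[OF G s(1)[OF that(1)] s(2)[OF that(1)] unit[OF that(1)] that(2)]
      wz[OF that] \<sigma>(2)[OF that(1)] by simp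
  with \<sigma>(1) that show thesis by blast
qed

lemma ex_step2:
  assumes G: "step1 m n k p r T G" and dist: "distinct_eigenvalues (N_xi n k p r G \<xi>)"
  shows "step2 n k p r \<xi> G (\<lambda>i t. u i (k + t))"
proof -
  define h where "h i = (\<Sum>a<r. (cmod (B0_vec i $ a))\<^sup>2)" for i
  define z where "z i = complex_of_real (1 / sqrt (h i)) \<cdot>\<^sub>v B0_vec i" for i
  have h_pos: "h i > 0" if i: "i < r" for i
  proof -
    obtain a where "a < r" "B0_vec i $ a \<noteq> 0" using B0_vec_nonzero[OF i] .
    then show ?thesis unfolding h_def by (intro sum_pos2[of _ a]) auto
  qed
  have hc: "B0_vec i \<bullet>c B0_vec i = complex_of_real (h i)" for i
    by (simp add: scalar_prod_def h_def atLeast0LessThan complex_norm_square[symmetric])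
  have unit: "z i \<bullet>c z i = 1" if i: "i < r" for i
  proof -
    let ?s = "complex_of_real (1 / sqrt (h i))"
    have "z i \<bullet>c z i = ?s * (?s * (B0_vec i \<bullet>c B0_vec i))"
      unfolding z_def conjugate_smult_vec
      by (simp add: smult_scalar_prod_distrib[of _ r] scalar_prod_smult_distrib[of _ r])
    also have "\<dots> = complex_of_real (1 / sqrt (h i) * (1 / sqrt (h i) * h i))"
      by (simp only: hc of_real_mult)
    also have "1 / sqrt (h i) * (1 / sqrt (h i) * h i) = 1"
      using h_pos[OF i] by (simp add: field_simps)
    finally show ?thesis by simp
  qed
  have "eigenvector (N_xi n k p r G \<xi>) (z i) (theta \<xi> i)" if i: "i < r" for i
  proof -
    have "N_xi n k p r G \<xi> *\<^sub>v B0_vec i = theta \<xi> i \<cdot>\<^sub>v B0_vec i"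
      using eigenvector_B0_vec[OF G i] by (simp add: eigenvector_def)
    then have "N_xi n k p r G \<xi> *\<^sub>v z i = theta \<xi> i \<cdot>\<^sub>v z i"
      unfolding z_def
      by (simp add: mult_mat_vec[OF N_xi_carrier B0_vec_carrier] smult_smult_assoc mult.commute)
    moreover have "z i \<noteq> 0\<^sub>v r" using unit[OF i] by auto
    ultimately show ?thesis by (simp add: eigenvector_def z_def)
  qed
  moreover have "u i (k + t) = (N_mat k p r G (k + t) *\<^sub>v z i) \<bullet>c z i"
    if "i < r" "t \<in> {1..n-k}" for i t
    using rayleigh_quotient[OF G that(1) _ unit[OF that(1)] that(2)] by (simp add: z_def)
  ultimately show ?thesis
    unfolding step2_def unit_eigenvectors_def using inj_on_theta[OF G dist] unit by blast
qed

definition gamma_opt :: "nat \<Rightarrow> mono \<Rightarrow> complex" where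
  "gamma_opt = (\<lambda>i\<in>{..<r}. \<lambda>\<beta>\<in>J1 k p. lam i * mono_eval \<beta> (u i))"

lemma eval_down:
  assumes "\<And>t. t \<in> {1..n-k} \<Longrightarrow> w t = u i (k + t)" "\<gamma> \<in> J2 m n k p"
  shows "mono_eval (down k \<gamma>) w = mono_eval \<gamma> (u i)"
  unfolding mono_eval_down
proof (rule mono_eval_cong)
  fix l assume "l \<in># \<gamma>"
  with J2D(1)[OF assms(2)] have l: "k + 1 \<le> l" "l \<le> n" by auto
  then have "l - k \<in> {1..n-k}" by auto
  from assms(1)[OF this] l
  show "w (l - k) = u i l" by simp
qed

lemma gamma_minimizer_iff:
  assumes w: "\<And>i t. i < r \<Longrightarrow> t \<in> {1..n-k} \<Longrightarrow> w i t = u i (k + t)"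
  shows "the_minimizer (obj_gamma m n k p r T w) ({..<r} \<rightarrow>\<^sub>E (J1 k p \<rightarrow>\<^sub>E UNIV)) g \<longleftrightarrow> g = gamma_opt"
proof -
  have zero: "obj_gamma m n k p r T w g = 0
      \<longleftrightarrow> (\<forall>\<beta>\<in>J1 k p. \<forall>i<r. g i \<beta> = lam i * mono_eval \<beta> (u i))" for g
  proof -
    have "obj_gamma m n k p r T w g = 0 \<longleftrightarrow> (\<forall>\<beta>\<in>J1 k p. \<forall>\<gamma>\<in>J2 m n k p.
        entry m T (\<beta> + \<gamma>) = (\<Sum>i<r. g i \<beta> * mono_eval (down k \<gamma>) (w i)))"
      by (simp add: obj_gamma_def sum_nonneg_eq_0_iff sum_nonneg finite_J1 finite_J2)
    also have "\<dots> \<longleftrightarrow> (\<forall>\<beta>\<in>J1 k p. \<forall>\<gamma>\<in>J2 m n k p.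
        (\<Sum>i<r. (lam i * mono_eval \<beta> (u i)) * mono_eval \<gamma> (u i)) = (\<Sum>i<r. g i \<beta> * mono_eval \<gamma> (u i)))"
    proof (intro ball_cong refl)
      fix \<beta> \<gamma> assume b: "\<beta> \<in> J1 k p" and c: "\<gamma> \<in> J2 m n k p"
      have "(\<Sum>i<r. g i \<beta> * mono_eval (down k \<gamma>) (w i)) = (\<Sum>i<r. g i \<beta> * mono_eval \<gamma> (u i))"
        by (intro sum.cong refl) (use eval_down[OF w c] in auto)
      then show "(entry m T (\<beta> + \<gamma>) = (\<Sum>i<r. g i \<beta> * mono_eval (down k \<gamma>) (w i)))
        = ((\<Sum>i<r. (lam i * mono_eval \<beta> (u i)) * mono_eval \<gamma> (u i)) = (\<Sum>i<r. g i \<beta> * mono_eval \<gamma> (u i)))"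
        unfolding entry_T_J1_J2[OF b c] by (simp add: mult_ac)
    qed
    also have "\<dots> \<longleftrightarrow> (\<forall>\<beta>\<in>J1 k p. \<forall>i<r. g i \<beta> = lam i * mono_eval \<beta> (u i))"
    proof (intro ball_cong refl iffI allI impI ballI)
      fix \<beta> i assume "\<forall>\<gamma>\<in>J2 m n k p.
        (\<Sum>i<r. (lam i * mono_eval \<beta> (u i)) * mono_eval \<gamma> (u i)) = (\<Sum>i<r. g i \<beta> * mono_eval \<gamma> (u i))"
        and i: "i < r"
      then show "g i \<beta> = lam i * mono_eval \<beta> (u i)"
        by (intro indep_eqD[OF indep_J2 _ i, of "\<lambda>i. g i \<beta>" "\<lambda>i. lam i * mono_eval \<beta> (u i)"]) auto
    qed (auto intro!: sum.cong)
    finally show ?thesis .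
  qed
  have "gamma_opt \<in> {..<r} \<rightarrow>\<^sub>E (J1 k p \<rightarrow>\<^sub>E UNIV)" by (auto simp: gamma_opt_def)
  moreover have "obj_gamma m n k p r T w gamma_opt = 0" by (simp add: zero gamma_opt_def)
  moreover have "0 \<le> obj_gamma m n k p r T w g" for g
    by (simp add: obj_gamma_def sum_nonneg)
  moreover have "h = gamma_opt" if h: "h \<in> {..<r} \<rightarrow>\<^sub>E (J1 k p \<rightarrow>\<^sub>E UNIV)" "obj_gamma m n k p r T w h = 0" for h
  proof (rule PiE_ext[OF h(1) \<open>gamma_opt \<in> _\<close>])
    fix i assume i: "i \<in> {..<r}"
    then have "h i \<in> J1 k p \<rightarrow>\<^sub>E UNIV" "gamma_opt i \<in> J1 k p \<rightarrow>\<^sub>E UNIV"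
      using h(1) by (auto simp: gamma_opt_def)
    then show "h i = gamma_opt i"
      by (rule PiE_ext) (use h(2) i in \<open>auto simp: zero gamma_opt_def\<close>)
  qed
  ultimately show ?thesis
    using the_minimizer_iff_unique_zero[of "obj_gamma m n k p r T w" gamma_opt
        "{..<r} \<rightarrow>\<^sub>E (J1 k p \<rightarrow>\<^sub>E UNIV)" g] by metis
qed

text \<open>
  Whether the equations for the \<open>j\<close>-th coordinates involve the \<open>i\<close>-th unknown at all: its coefficients
  are multiples of the values \<open>x\<^sup>\<beta>(u\<^sub>i)\<close>.
\<close>

definition determined :: "nat \<Rightarrow> nat \<Rightarrow> bool" where
  "determined i j \<longleftrightarrow> (\<exists>\<beta>\<in>J1_minus k p j. mono_eval \<beta> (u i) \<noteq> 0)"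

text \<open>
  Independence on \<open>J\<^sub>2\<close> decouples the unknowns: for each \<open>i\<close> and \<open>\<beta>\<close> there remains the single equation
  \<open>(u\<^sub>i)\<^sub>j x\<^sup>\<beta>(u\<^sub>i) = y\<^sub>i x\<^sup>\<beta>(u\<^sub>i)\<close>.
\<close>

lemma obj_v_eq_0_iff:
  assumes w: "\<And>i t. i < r \<Longrightarrow> t \<in> {1..n-k} \<Longrightarrow> w i t = u i (k + t)" and j: "j \<in> {1..k}"
  shows "obj_v m n k p r T w gamma_opt j y = 0 \<longleftrightarrow> (\<forall>i<r. determined i j \<longrightarrow> y i = u i j)"
proof -
  have fin: "finite (J1_minus k p j)" by (simp add: J1_minus_def finite_J1)
  have "obj_v m n k p r T w gamma_opt j y = 0 \<longleftrightarrow> (\<forall>\<beta>\<in>J1_minus k p j. \<forall>\<gamma>\<in>J2 m n k p.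
      entry m T ({#j#} + \<beta> + \<gamma>) = (\<Sum>i<r. y i * gamma_opt i \<beta> * mono_eval (down k \<gamma>) (w i)))"
    unfolding obj_v_def
    by (simp add: sum_nonneg_eq_0_iff sum_nonneg fin finite_J2)
  also have "\<dots> \<longleftrightarrow> (\<forall>\<beta>\<in>J1_minus k p j. \<forall>\<gamma>\<in>J2 m n k p.
      (\<Sum>i<r. (u i j * mono_eval \<beta> (u i)) * (lam i * mono_eval \<gamma> (u i)))
        = (\<Sum>i<r. (y i * mono_eval \<beta> (u i)) * (lam i * mono_eval \<gamma> (u i))))"
  proof (intro ball_cong refl)
    fix \<beta> \<gamma> assume b: "\<beta> \<in> J1_minus k p j" and c: "\<gamma> \<in> J2 m n k p"
    then have b': "\<beta> \<in> J1 k p" "j \<notin># \<beta>" by (auto simp: J1_minus_def)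
    have "j \<notin># \<gamma>" "j \<in> {1..n}" using J2D(1)[OF c] j k_lt_n by auto
    note e = entry_T_extra[OF b'(1) c this(2) b'(2) this(1)]
    have "(\<Sum>i<r. y i * gamma_opt i \<beta> * mono_eval (down k \<gamma>) (w i))
        = (\<Sum>i<r. (y i * mono_eval \<beta> (u i)) * (lam i * mono_eval \<gamma> (u i)))"
      by (intro sum.cong refl) (use eval_down[OF w c] b'(1) in \<open>auto simp: gamma_opt_def\<close>)
    with e show "(entry m T ({#j#} + \<beta> + \<gamma>) = (\<Sum>i<r. y i * gamma_opt i \<beta> * mono_eval (down k \<gamma>) (w i)))
      = ((\<Sum>i<r. (u i j * mono_eval \<beta> (u i)) * (lam i * mono_eval \<gamma> (u i)))
        = (\<Sum>i<r. (y i * mono_eval \<beta> (u i)) * (lam i * mono_eval \<gamma> (u i))))" by simp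
  qed
  also have "\<dots> \<longleftrightarrow> (\<forall>\<beta>\<in>J1_minus k p j. \<forall>i<r. u i j * mono_eval \<beta> (u i) = y i * mono_eval \<beta> (u i))"
  proof (intro ball_cong refl iffI allI impI ballI)
    fix \<beta> i assume "\<forall>\<gamma>\<in>J2 m n k p.
      (\<Sum>i<r. (u i j * mono_eval \<beta> (u i)) * (lam i * mono_eval \<gamma> (u i)))
        = (\<Sum>i<r. (y i * mono_eval \<beta> (u i)) * (lam i * mono_eval \<gamma> (u i)))" and i: "i < r"
    then show "u i j * mono_eval \<beta> (u i) = y i * mono_eval \<beta> (u i)"
      by (intro indep_eqD[OF indep_lam_J2 _ i,
            of "\<lambda>i. u i j * mono_eval \<beta> (u i)" "\<lambda>i. y i * mono_eval \<beta> (u i)"]) auto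
  qed (auto intro!: sum.cong)
  also have "\<dots> \<longleftrightarrow> (\<forall>i<r. determined i j \<longrightarrow> y i = u i j)"
    by (simp add: determined_def) metis
  finally show ?thesis .
qed

text \<open>
  If an unknown is not determined, changing it gives another minimizer, so there is no unique one.
\<close>

lemma v_minimizer_iff:
  assumes w: "\<And>i t. i < r \<Longrightarrow> t \<in> {1..n-k} \<Longrightarrow> w i t = u i (k + t)" and j: "j \<in> {1..k}"
  shows "the_minimizer (obj_v m n k p r T w gamma_opt j) ({..<r} \<rightarrow>\<^sub>E UNIV) y
    \<longleftrightarrow> y = (\<lambda>i\<in>{..<r}. u i j) \<and> (\<forall>i<r. determined i j)"
proof -
  let ?y = "\<lambda>i\<in>{..<r}. u i j"
  have zero: "obj_v m n k p r T w gamma_opt j y = 0 \<longleftrightarrow> (\<forall>i<r. determined i j \<longrightarrow> y i = u i j)" for y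
    by (intro obj_v_eq_0_iff w j)
  have y_zero: "?y \<in> {..<r} \<rightarrow>\<^sub>E UNIV" "obj_v m n k p r T w gamma_opt j ?y = 0" by (auto simp: zero)
  have nonneg: "0 \<le> obj_v m n k p r T w gamma_opt j y" for y by (simp add: obj_v_def sum_nonneg)
  have "the_minimizer (obj_v m n k p r T w gamma_opt j) ({..<r} \<rightarrow>\<^sub>E UNIV) y
    \<longleftrightarrow> y \<in> {..<r} \<rightarrow>\<^sub>E UNIV \<and> obj_v m n k p r T w gamma_opt j y = 0
      \<and> (\<forall>y'\<in>{..<r} \<rightarrow>\<^sub>E UNIV. obj_v m n k p r T w gamma_opt j y' = 0 \<longrightarrow> y' = y)"
    by (rule the_minimizer_iff_unique_zero[of "obj_v m n k p r T w gamma_opt j", OF nonneg y_zero])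
  also have "\<dots> \<longleftrightarrow> y = ?y \<and> (\<forall>i<r. determined i j)"
  proof (intro iffI conjI allI impI)
    assume H: "y \<in> {..<r} \<rightarrow>\<^sub>E UNIV \<and> obj_v m n k p r T w gamma_opt j y = 0
      \<and> (\<forall>y'\<in>{..<r} \<rightarrow>\<^sub>E UNIV. obj_v m n k p r T w gamma_opt j y' = 0 \<longrightarrow> y' = y)"
    with y_zero show "y = ?y" by blast
    fix i assume i: "i < r"
    show "determined i j"
    proof (rule ccontr)
      assume nv: "\<not> determined i j"
      let ?y' = "y(i := y i + 1)"
      have "?y' \<in> {..<r} \<rightarrow>\<^sub>E UNIV" using H i by (auto simp: PiE_iff extensional_def)
      moreover have "obj_v m n k p r T w gamma_opt j ?y' = 0" using H nv by (auto simp: zero)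
      ultimately have "?y' = y" using H by blast
      from fun_cong[OF this, of i] show False by simp
    qed
  next
    assume H: "y = ?y \<and> (\<forall>i<r. determined i j)"
    with y_zero show "y \<in> {..<r} \<rightarrow>\<^sub>E UNIV" "obj_v m n k p r T w gamma_opt j y = 0" by simp_all
    show "\<forall>y'\<in>{..<r} \<rightarrow>\<^sub>E UNIV. obj_v m n k p r T w gamma_opt j y' = 0 \<longrightarrow> y' = y"
    proof (intro ballI impI)
      fix y' assume y': "y' \<in> {..<r} \<rightarrow>\<^sub>E UNIV" "obj_v m n k p r T w gamma_opt j y' = 0"
      have "y \<in> {..<r} \<rightarrow>\<^sub>E UNIV" using H by auto
      with y'(1) show "y' = y" by (rule PiE_ext) (use H y'(2) in \<open>auto simp: zero\<close>)
    qed
  qed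
  finally show ?thesis .
qed

text \<open>
  Among the tuples without repetition are those of \<open>x\<^sub>0 x\<^sup>\<beta> x\<^sup>\<gamma>\<close>. At these, independence on
  \<open>J\<^sub>2\<close> yields \<open>c\<^sub>i x\<^sup>\<beta>(u\<^sub>i) = \<lambda>\<^sub>i x\<^sup>\<beta>(u\<^sub>i)\<close>, and some \<open>x\<^sup>\<beta>(u\<^sub>i)\<close> with \<open>\<beta> \<in> \<B>\<^sub>0\<close> is nonzero.
\<close>

lemma lambda_minimizer_iff:
  assumes u': "\<And>i l. i < r \<Longrightarrow> l \<in> {1..n} \<Longrightarrow> u' i l = u i l"
  shows "the_minimizer (obj_lambda m n r T u') ({..<r} \<rightarrow>\<^sub>E UNIV) c \<longleftrightarrow> c = (\<lambda>i\<in>{..<r}. lam i)"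
proof -
  let ?c = "\<lambda>i\<in>{..<r}. lam i"
  have zero: "obj_lambda m n r T u' c = 0 \<longleftrightarrow> (\<forall>is\<in>Omega m n.
      (\<Sum>i<r. lam i * tensor_power (hom1 (u i)) is) = (\<Sum>i<r. c i * tensor_power (hom1 (u i)) is))" for c
  proof -
    have "obj_lambda m n r T u' c = 0 \<longleftrightarrow> (\<forall>is\<in>Omega m n.
      T is = (\<Sum>i<r. c i * tensor_power (hom1 (u' i)) is))"
      by (simp add: obj_lambda_def sum_nonneg_eq_0_iff finite_Omega)
    also have "\<dots> \<longleftrightarrow> (\<forall>is\<in>Omega m n.
      (\<Sum>i<r. lam i * tensor_power (hom1 (u i)) is) = (\<Sum>i<r. c i * tensor_power (hom1 (u i)) is))"
    proof (intro ball_cong refl)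
      fix "is" assume "is": "is \<in> Omega m n"
      then have t: "is \<in> tuples m n" by (simp add: Omega_def)
      have "tensor_power (hom1 (u' i)) is = tensor_power (hom1 (u i)) is" if "i < r" for i
        using t by (rule tensor_power_cong) (use u' that in \<open>auto simp: hom1_def\<close>)
      then have "(\<Sum>i<r. c i * tensor_power (hom1 (u' i)) is) = (\<Sum>i<r. c i * tensor_power (hom1 (u i)) is)"
        by (intro sum.cong refl) auto
      moreover have "T is = (\<Sum>i<r. lam i * tensor_power (hom1 (u i)) is)"
        using F_eq t "is" by (simp add: tensor_eq_def)
      ultimately show "(T is = (\<Sum>i<r. c i * tensor_power (hom1 (u' i)) is))
        = ((\<Sum>i<r. lam i * tensor_power (hom1 (u i)) is) = (\<Sum>i<r. c i * tensor_power (hom1 (u i)) is))"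
        by simp
    qed
    finally show ?thesis .
  qed
  have "c i = lam i" if c: "obj_lambda m n r T u' c = 0" and i: "i < r" for c i
  proof -
    have ind: "c i * mono_eval \<beta> (u i) = lam i * mono_eval \<beta> (u i)" if \<beta>: "\<beta> \<in> B0 k p r" for \<beta>
    proof (rule indep_eqD[OF indep_J2 _ i, of "\<lambda>i. c i * mono_eval \<beta> (u i)" "\<lambda>i. lam i * mono_eval \<beta> (u i)"])
      fix \<gamma> assume \<gamma>: "\<gamma> \<in> J2 m n k p"
      note J = J1_J2_monos[OF B0D[OF \<beta>] \<gamma>]
      have "padded m (\<beta> + \<gamma>) \<in> Omega m n" using J by (intro padded_in_Omega) auto
      with c have "(\<Sum>i<r. lam i * tensor_power (hom1 (u i)) (padded m (\<beta> + \<gamma>)))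
          = (\<Sum>i<r. c i * tensor_power (hom1 (u i)) (padded m (\<beta> + \<gamma>)))"
        unfolding zero by blast
      then show "(\<Sum>i<r. c i * mono_eval \<beta> (u i) * mono_eval \<gamma> (u i))
          = (\<Sum>i<r. lam i * mono_eval \<beta> (u i) * mono_eval \<gamma> (u i))"
        by (simp add: tensor_power_hom1_padded[OF J(1)] mult.assoc)
    qed
    obtain \<beta> where "\<beta> \<in> B0 k p r" "mono_eval \<beta> (u i) \<noteq> 0"
      using indep_nonzero[OF indep_B0 i] .
    with ind show ?thesis by auto
  qed
  then have "h = ?c" if "h \<in> {..<r} \<rightarrow>\<^sub>E UNIV" "obj_lambda m n r T u' h = 0" for h
    using that by (intro PiE_ext[OF that(1), of ?c]) auto
  moreover have "?c \<in> {..<r} \<rightarrow>\<^sub>E UNIV" "obj_lambda m n r T u' ?c = 0" by (simp_all add: zero)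
  moreover have "0 \<le> obj_lambda m n r T u' c" for c by (simp add: obj_lambda_def sum_nonneg)
  ultimately show ?thesis
    using the_minimizer_iff_unique_zero[of "obj_lambda m n r T u'" ?c "{..<r} \<rightarrow>\<^sub>E UNIV" c] by metis
qed

lemma join_eq:
  assumes "\<And>i t. i < r \<Longrightarrow> t \<in> {1..n-k} \<Longrightarrow> w i t = u i (k + t)"
    and "\<And>j. j \<in> {1..k} \<Longrightarrow> v j = (\<lambda>i\<in>{..<r}. u i j)"
    and "i < r" "l \<in> {1..n}"
  shows "join k v w i l = u i l"
proof (cases "l \<le> k")
  case True
  with assms(2)[of l] assms(3,4) show ?thesis by (simp add: join_def)
next
  case False
  then have "l - k \<in> {1..n-k}" using assms(4) by auto
  from assms(1)[OF assms(3) this] False show ?thesis by (simp add: join_def)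
qed

lemma step3_iff:
  assumes w: "\<And>i t. i < r \<Longrightarrow> t \<in> {1..n-k} \<Longrightarrow> w i t = u i (k + t)"
  shows "step3 m n k p r T w v c \<longleftrightarrow>
    (\<forall>j\<in>{1..k}. v j = (\<lambda>i\<in>{..<r}. u i j)) \<and> (\<forall>i<r. \<forall>j\<in>{1..k}. determined i j) \<and> c = (\<lambda>i\<in>{..<r}. lam i)"
proof -
  have gm: "the_minimizer (obj_gamma m n k p r T w) ({..<r} \<rightarrow>\<^sub>E (J1 k p \<rightarrow>\<^sub>E UNIV)) g \<longleftrightarrow> g = gamma_opt" for g
    by (intro gamma_minimizer_iff w)
  have vm: "the_minimizer (obj_v m n k p r T w gamma_opt j) ({..<r} \<rightarrow>\<^sub>E UNIV) y
    \<longleftrightarrow> y = (\<lambda>i\<in>{..<r}. u i j) \<and> (\<forall>i<r. determined i j)" if "j \<in> {1..k}" for j y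
    by (intro v_minimizer_iff w that)
  have "step3 m n k p r T w v c \<longleftrightarrow>
    (\<forall>j\<in>{1..k}. the_minimizer (obj_v m n k p r T w gamma_opt j) ({..<r} \<rightarrow>\<^sub>E UNIV) (v j)) \<and>
    the_minimizer (obj_lambda m n r T (join k v w)) ({..<r} \<rightarrow>\<^sub>E UNIV) c"
    unfolding step3_def gm by blast
  also have "\<dots> \<longleftrightarrow> (\<forall>j\<in>{1..k}. v j = (\<lambda>i\<in>{..<r}. u i j) \<and> (\<forall>i<r. determined i j)) \<and>
    the_minimizer (obj_lambda m n r T (join k v w)) ({..<r} \<rightarrow>\<^sub>E UNIV) c"
    by (intro conj_cong ball_cong refl vm)
  also have "\<dots> \<longleftrightarrow> (\<forall>j\<in>{1..k}. v j = (\<lambda>i\<in>{..<r}. u i j) \<and> (\<forall>i<r. determined i j)) \<and>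
    c = (\<lambda>i\<in>{..<r}. lam i)"
  proof (rule conj_cong[OF refl])
    assume "\<forall>j\<in>{1..k}. v j = (\<lambda>i\<in>{..<r}. u i j) \<and> (\<forall>i<r. determined i j)"
    then show "the_minimizer (obj_lambda m n r T (join k v w)) ({..<r} \<rightarrow>\<^sub>E UNIV) c
      = (c = (\<lambda>i\<in>{..<r}. lam i))"
      by (intro lambda_minimizer_iff join_eq w) auto
  qed
  finally show ?thesis by blast
qed

lemma decomposes_roots:
  assumes q: "\<And>i l. i < r \<Longrightarrow> l \<le> n \<Longrightarrow> q i l = lam i powr (1 / of_nat m) * hom1 (u i) l"
  shows "decomposes m n r F q"
  unfolding decomposes_def tensor_eq_def
proof
  fix "is" assume "is": "is \<in> tuples m n"
  have "tensor_power (q i) is = lam i * tensor_power (hom1 (u i)) is" if i: "i < r" for i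
  proof -
    have "tensor_power (q i) is
        = tensor_power (\<lambda>l. lam i powr (1 / of_nat m) * hom1 (u i) l) is"
      using "is" by (rule tensor_power_cong) (simp add: q i)
    also have "\<dots> = (lam i powr (1 / of_nat m)) ^ m * tensor_power (hom1 (u i)) is"
      using "is" by (simp add: tensor_power_scale tuples_def)
    also have "(lam i powr (1 / of_nat m)) ^ m = lam i"
      using lam_nz[OF i] p_le_m by (intro powr_root_power) auto
    finally show ?thesis .
  qed
  with F_eq "is" show "F is = (\<Sum>i<r. tensor_power (q i) is)" by (simp add: tensor_eq_def)
qed

section \<open>Rank and uniqueness\<close>

text \<open>
  The entry of degree \<open>m - 1\<close> of \<open>q\<^sub>i\<^sup>\<otimes>\<^sup>m\<close> at \<open>\<beta> + \<gamma>\<close> is \<open>(q\<^sub>i)\<^sub>0 x\<^sup>\<gamma>(q\<^sub>i) x\<^sup>\<beta>(q\<^sub>i)\<close>. The factors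
  \<open>(q\<^sub>i)\<^sub>0 x\<^sup>\<gamma>(q\<^sub>i)\<close> form an independent family, so none of them vanishes identically.
\<close>

lemma first_coordinate_nonzero:
  assumes q: "decomposes m n r F q" and i: "i < r"
  shows "q i 0 \<noteq> 0"
proof -
  have "indep r (\<lambda>i \<gamma>. q i 0 * mono_eval \<gamma> (q i)) (J2 m n k p)"
  proof (rule indep_of_same_bilinear_sum[OF finite_J2 finite_B0 indep_lam_J2 indep_B0])
    fix \<gamma> \<beta> assume \<gamma>: "\<gamma> \<in> J2 m n k p" and \<beta>: "\<beta> \<in> B0 k p r"
    note J = J1_J2_monos[OF B0D[OF \<beta>] \<gamma>]
    have "set_mset (\<beta> + \<gamma>) \<subseteq> {0..n}" "size (\<beta> + \<gamma>) \<le> m" using J(1,2) by auto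
    then have "padded m (\<beta> + \<gamma>) \<in> tuples m n" by (rule padded_in_tuples)
    then have "entry m F (\<beta> + \<gamma>) = (\<Sum>i<r. tensor_power (q i) (padded m (\<beta> + \<gamma>)))"
      using q by (simp add: decomposes_def tensor_eq_def entry_eq_padded)
    also have "\<dots> = (\<Sum>i<r. q i 0 * mono_eval \<gamma> (q i) * mono_eval \<beta> (q i))"
      using J(2) p_le_m unfolding tensor_power_padded by (simp add: mult_ac)
    also have "entry m F (\<beta> + \<gamma>) = (\<Sum>i<r. lam i * mono_eval \<gamma> (u i) * mono_eval \<beta> (u i))"
      using J by (subst entry_F) (auto simp: mult_ac)
    finally show "(\<Sum>i<r. lam i * mono_eval \<gamma> (u i) * mono_eval \<beta> (u i))
      = (\<Sum>i<r. q i 0 * mono_eval \<gamma> (q i) * mono_eval \<beta> (q i))" .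
  qed
  from indep_nonzero[OF this i] show ?thesis by auto
qed

text \<open>
  A shorter decomposition, padded with zero vectors to length \<open>r\<close>, would have a summand with first
  coordinate zero.
\<close>

lemma decomposes_length:
  assumes q: "decomposes m n s F q"
  shows "r \<le> s"
proof (rule ccontr)
  assume "\<not> r \<le> s"
  then have s: "s < r" by simp
  define q' where "q' i = (if i < s then q i else (\<lambda>_. 0))" for i
  have "decomposes m n r F q'"
    unfolding decomposes_def tensor_eq_def
  proof
    fix "is" assume "is": "is \<in> tuples m n"
    then have "is \<noteq> []" using p_le_m by (auto simp: tuples_def)
    then have zero: "tensor_power (\<lambda>_. 0) is = 0" by (cases "is") (auto simp: tensor_power_def)
    have "(\<Sum>i<s. tensor_power (q i) is) = (\<Sum>i<r. tensor_power (q' i) is)"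
      by (rule sum.mono_neutral_cong_left) (use s zero in \<open>auto simp: q'_def\<close>)
    with q "is" show "F is = (\<Sum>i<r. tensor_power (q' i) is)"
      by (simp add: decomposes_def tensor_eq_def)
  qed
  from first_coordinate_nonzero[OF this s] show False by (simp add: q'_def)
qed

lemma ex_decomposes: "\<exists>q. decomposes m n r F q"
  using decomposes_roots[of "\<lambda>i l. lam i powr (1 / of_nat m) * hom1 (u i) l"] by blast

lemma symmetric_rank_eq: "symmetric_rank m n F = r"
  unfolding symmetric_rank_def
  by (rule Least_equality) (use ex_decomposes decomposes_length in auto)

lemma rank_decomposition_iff: "rank_decomposition m n r F q \<longleftrightarrow> decomposes m n r F q"
  by (simp add: rank_decomposition_def symmetric_rank_eq)

text \<open>
  The matrices \<open>F\<^bsub>\<beta>+\<gamma>\<^esub>\<close>, with \<open>\<gamma>\<close> ranging over \<open>J\<^sub>2\<close> or over one \<open>\<O>\<^sub>\<alpha>\<close>, have rank \<open>r\<close>. Computed from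
  the new decomposition, they are sums of \<open>r\<close> products, whose factors are therefore independent.
\<close>

lemma decomposition_is_generic:
  assumes q: "decomposes m n r F q"
  shows "generic_decomposition m n k p r F (\<lambda>i. q i 0 ^ m) (\<lambda>i l. q i l / q i 0)"
proof
  let ?lam = "\<lambda>i. q i 0 ^ m" and ?u = "\<lambda>i l. q i l / q i 0"
  show nz: "?lam i \<noteq> 0" if "i < r" for i
    using first_coordinate_nonzero[OF q that] by simp
  show F': "tensor_eq m n F (\<lambda>is. \<Sum>i<r. ?lam i * tensor_power (hom1 (?u i)) is)"
    unfolding tensor_eq_def
  proof
    fix "is" assume "is": "is \<in> tuples m n"
    with q have "F is = (\<Sum>i<r. tensor_power (q i) is)" by (simp add: decomposes_def tensor_eq_def)
    also have "\<dots> = (\<Sum>i<r. ?lam i * tensor_power (hom1 (?u i)) is)"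
      by (intro sum.cong refl tensor_power_dehomogenize)
        (use first_coordinate_nonzero[OF q] "is" in \<open>auto simp: tuples_def\<close>)
    finally show "F is = (\<Sum>i<r. ?lam i * tensor_power (hom1 (?u i)) is)" .
  qed
  have same: "(\<Sum>i<r. lam i * mono_eval (\<beta> + \<gamma>) (u i)) = (\<Sum>i<r. ?lam i * mono_eval (\<beta> + \<gamma>) (?u i))"
    if "\<beta> \<in> B0 k p r" "\<gamma> \<in> J2 m n k p" for \<beta> \<gamma>
  proof -
    note J = J1_J2_monos[OF B0D[OF that(1)] that(2)]
    have "size (\<beta> + \<gamma>) \<le> m" using J(2) by simp
    from entry_F[OF J(1) this] entry_eq_sum[OF F' J(1) this] show ?thesis by simp
  qed
  show "indep r (\<lambda>i \<beta>. mono_eval \<beta> (?u i)) (B0 k p r)"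
    by (rule indep_of_same_bilinear_sum[OF finite_B0 finite_J2 indep_B0 indep_lam_J2,
          where b' = "\<lambda>i \<gamma>. ?lam i * mono_eval \<gamma> (?u i)"])
      (use same in \<open>simp add: mult_ac\<close>)
  show "indep r (\<lambda>i \<gamma>. mono_eval \<gamma> (?u i)) (O_set m n k p \<alpha>)" if \<alpha>: "\<alpha> \<in> B1 n k p" for \<alpha>
  proof (rule indep_of_same_bilinear_sum[OF finite_O_set finite_B0 indep_O[OF \<alpha>],
          where b = "\<lambda>i \<beta>. lam i * mono_eval \<beta> (u i)"
            and b' = "\<lambda>i \<beta>. ?lam i * mono_eval \<beta> (?u i)"])
    show "indep r (\<lambda>i \<beta>. lam i * mono_eval \<beta> (u i)) (B0 k p r)"
      using indep_B0 lam_nz by (rule indep_scale)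
    fix \<gamma> \<beta> assume "\<gamma> \<in> O_set m n k p \<alpha>" and \<beta>: "\<beta> \<in> B0 k p r"
    then have "\<gamma> \<in> J2 m n k p" using O_set_subset_J2 by blast
    from same[OF \<beta> this]
    show "(\<Sum>i<r. mono_eval \<gamma> (u i) * (lam i * mono_eval \<beta> (u i)))
      = (\<Sum>i<r. mono_eval \<gamma> (?u i) * (?lam i * mono_eval \<beta> (?u i)))"
      by (simp add: mult_ac)
  qed
qed (fact p_le_m p_le_k k_bound r_le)+

text \<open>
  Both decompositions give eigenvectors of the same matrices \<open>N\<^sub>l(G)\<close>, which matches the points in the
  coordinates \<open>k+1, \<dots>, n\<close>. For the other coordinates, the entries at \<open>\<beta> + \<gamma>\<close> and \<open>e\<^sub>l + \<beta> + \<gamma>\<close> are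
  available for every \<open>l\<close>, as the full tensor is known: after the matching, both
  expansions use the same independent vectors \<open>[u'\<^sub>i]\<^bsub>J\<^sub>2\<^esub>\<close>, and the quotient of the two coefficients is
  the coordinate.
\<close>

lemma unique_up_to_permutation:
  assumes second: "generic_decomposition m n k p r F lam' u'"
    and dist: "\<forall>G. step1 m n k p r T G \<longrightarrow> distinct_eigenvalues (N_xi n k p r G \<xi>)"
  obtains \<pi> where "\<pi> permutes {..<r}" "\<And>i. i < r \<Longrightarrow> lam' i = lam (\<pi> i)"
    "\<And>i l. i < r \<Longrightarrow> l \<in> {1..n} \<Longrightarrow> u' i l = u (\<pi> i) l"
proof -
  interpret S: generic_decomposition m n k p r F lam' u' by (fact second)
  obtain G where G: "step1 m n k p r T G" using ex_step1 by blast
  with dist have d: "distinct_eigenvalues (N_xi n k p r G \<xi>)" by blast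
  have "\<exists>s x. s < r \<and> S.B0_vec i = x \<cdot>\<^sub>v B0_vec s \<and> S.theta \<xi> i = theta \<xi> s" if "i < r" for i
    by (rule eigenvector_is_multiple_of_B0_vec[OF G d S.eigenvector_B0_vec[OF G that]]) blast
  then obtain s x where s: "\<And>i. i < r \<Longrightarrow> s i < r" "\<And>i. i < r \<Longrightarrow> S.B0_vec i = x i \<cdot>\<^sub>v B0_vec (s i)"
      "\<And>i. i < r \<Longrightarrow> S.theta \<xi> i = theta \<xi> (s i)"
    by metis
  have "inj_on s {..<r}"
  proof (rule inj_onI)
    fix i j assume ij: "i \<in> {..<r}" "j \<in> {..<r}" "s i = s j"
    then have "S.theta \<xi> i = S.theta \<xi> j" by (simp add: s(3))
    then show "i = j" using ij(1,2) by (rule inj_onD[OF S.inj_on_theta[OF G d]])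
  qed
  then obtain \<pi> where \<pi>: "\<pi> permutes {..<r}" "\<And>i. i < r \<Longrightarrow> \<pi> i = s i"
    using inj_on_imp_permutes s(1) by blast
  have \<pi>_less: "\<pi> i < r" if "i < r" for i using \<pi>(2) s(1) that by simp
  have w_eq: "u' i l = u (\<pi> i) l" if i: "i < r" and l: "l \<in> {k+1..n}" for i l
  proof -
    obtain a where a: "a < r" "S.B0_vec i $ a \<noteq> 0" using S.B0_vec_nonzero[OF i] .
    have "u' i l \<cdot>\<^sub>v S.B0_vec i = N_mat k p r G l *\<^sub>v S.B0_vec i" using S.N_mat_B0_vec[OF G l i] by simp
    also have "\<dots> = x i \<cdot>\<^sub>v (u (\<pi> i) l \<cdot>\<^sub>v B0_vec (\<pi> i))"
      using N_mat_B0_vec[OF G l \<pi>_less[OF i]]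
      by (simp add: s(2)[OF i] \<pi>(2)[OF i] mult_mat_vec[OF N_mat_carrier B0_vec_carrier])
    also have "\<dots> = u (\<pi> i) l \<cdot>\<^sub>v S.B0_vec i"
      by (simp add: s(2)[OF i] \<pi>(2)[OF i] smult_smult_assoc mult.commute)
    finally have "(u' i l \<cdot>\<^sub>v S.B0_vec i) $ a = (u (\<pi> i) l \<cdot>\<^sub>v S.B0_vec i) $ a" by simp
    with a show ?thesis by simp
  qed
  have eval_J2: "mono_eval \<gamma> (u (\<pi> i)) = mono_eval \<gamma> (u' i)" if "i < r" "\<gamma> \<in> J2 m n k p" for i \<gamma>
    by (rule mono_eval_cong) (use J2D(1)[OF that(2)] w_eq[OF that(1)] in force)
  \<comment> \<open>Used with \<open>f\<close> constantly \<open>1\<close> and with \<open>f\<close> the \<open>l\<close>-th coordinate.\<close>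
  have coeff: "lam (\<pi> i) * f (u (\<pi> i)) * mono_eval \<beta> (u (\<pi> i)) = lam' i * f (u' i) * mono_eval \<beta> (u' i)"
    if i: "i < r" and \<beta>: "\<beta> \<in> B0 k p r"
      and f: "\<And>\<gamma>. \<gamma> \<in> J2 m n k p \<Longrightarrow> (\<Sum>i<r. lam i * f (u i) * mono_eval \<beta> (u i) * mono_eval \<gamma> (u i))
        = (\<Sum>i<r. lam' i * f (u' i) * mono_eval \<beta> (u' i) * mono_eval \<gamma> (u' i))" for i \<beta> f
  proof (rule indep_eqD[OF S.indep_J2 _ i])
    fix \<gamma> assume \<gamma>: "\<gamma> \<in> J2 m n k p"
    have "(\<Sum>i<r. lam (\<pi> i) * f (u (\<pi> i)) * mono_eval \<beta> (u (\<pi> i)) * mono_eval \<gamma> (u' i))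
      = (\<Sum>i<r. lam (\<pi> i) * f (u (\<pi> i)) * mono_eval \<beta> (u (\<pi> i)) * mono_eval \<gamma> (u (\<pi> i)))"
      by (intro sum.cong refl) (use eval_J2 \<gamma> in simp)
    also have "\<dots> = (\<Sum>i<r. lam i * f (u i) * mono_eval \<beta> (u i) * mono_eval \<gamma> (u i))"
      using sum.permute[OF \<pi>(1), of "\<lambda>i. lam i * f (u i) * mono_eval \<beta> (u i) * mono_eval \<gamma> (u i)"]
      by (simp add: comp_def)
    finally show "(\<Sum>i<r. lam (\<pi> i) * f (u (\<pi> i)) * mono_eval \<beta> (u (\<pi> i)) * mono_eval \<gamma> (u' i))
      = (\<Sum>i<r. lam' i * f (u' i) * mono_eval \<beta> (u' i) * mono_eval \<gamma> (u' i))"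
      using f[OF \<gamma>] by simp
  qed
  have coeff_1: "lam (\<pi> i) * mono_eval \<beta> (u (\<pi> i)) = lam' i * mono_eval \<beta> (u' i)"
    if "i < r" "\<beta> \<in> B0 k p r" for i \<beta>
  proof -
    have "(\<Sum>i<r. lam i * 1 * mono_eval \<beta> (u i) * mono_eval \<gamma> (u i))
        = (\<Sum>i<r. lam' i * 1 * mono_eval \<beta> (u' i) * mono_eval \<gamma> (u' i))" if "\<gamma> \<in> J2 m n k p" for \<gamma>
      using entry_T_J1_J2[OF B0D[OF \<open>\<beta> \<in> _\<close>] that] S.entry_T_J1_J2[OF B0D[OF \<open>\<beta> \<in> _\<close>] that]
      by (simp add: mult_ac)
    from coeff[OF that, of "\<lambda>_. 1", OF this] show ?thesis by simp
  qed
  have coeff_l: "lam (\<pi> i) * u (\<pi> i) l * mono_eval \<beta> (u (\<pi> i)) = lam' i * u' i l * mono_eval \<beta> (u' i)"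
    if "i < r" "\<beta> \<in> B0 k p r" and l: "l \<in> {1..n}" for i \<beta> l
  proof (rule coeff[OF that(1,2), of "\<lambda>v. v l"])
    fix \<gamma> assume "\<gamma> \<in> J2 m n k p"
    from entry_F_extra[OF B0D[OF that(2)] this l] S.entry_F_extra[OF B0D[OF that(2)] this l]
    show "(\<Sum>i<r. lam i * u i l * mono_eval \<beta> (u i) * mono_eval \<gamma> (u i))
        = (\<Sum>i<r. lam' i * u' i l * mono_eval \<beta> (u' i) * mono_eval \<gamma> (u' i))"
      by (simp add: mult_ac)
  qed
  have u_eq: "u' i l = u (\<pi> i) l" if i: "i < r" and l: "l \<in> {1..n}" for i l
  proof -
    obtain \<beta> where \<beta>: "\<beta> \<in> B0 k p r" "mono_eval \<beta> (u' i) \<noteq> 0"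
      using indep_nonzero[OF S.indep_B0 i] .
    have "u (\<pi> i) l * (lam' i * mono_eval \<beta> (u' i)) = u' i l * (lam' i * mono_eval \<beta> (u' i))"
      using coeff_l[OF i \<beta>(1) l] coeff_1[OF i \<beta>(1)] by (metis mult.commute mult.left_commute)
    with \<beta>(2) S.lam_nz[OF i] show ?thesis by simp
  qed
  have "lam' i = lam (\<pi> i)" if i: "i < r" for i
  proof -
    obtain \<beta> where \<beta>: "\<beta> \<in> B0 k p r" "mono_eval \<beta> (u' i) \<noteq> 0"
      using indep_nonzero[OF S.indep_B0 i] .
    have "mono_eval \<beta> (u (\<pi> i)) = mono_eval \<beta> (u' i)"
      by (rule mono_eval_cong) (use J1D(1)[OF B0D[OF \<beta>(1)]] k_lt_n u_eq[OF i] in force)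
    with coeff_1[OF i \<beta>(1)] \<beta>(2) show ?thesis by simp
  qed
  with \<pi>(1) u_eq that show thesis by blast
qed

lemma decomposition_terms:
  assumes q: "decomposes m n r F q"
    and dist: "\<forall>G. step1 m n k p r T G \<longrightarrow> distinct_eigenvalues (N_xi n k p r G \<xi>)"
  obtains \<pi> where "\<pi> permutes {..<r}"
    "\<And>i is. i < r \<Longrightarrow> is \<in> tuples m n
      \<Longrightarrow> tensor_power (q i) is = lam (\<pi> i) * tensor_power (hom1 (u (\<pi> i))) is"
proof -
  obtain \<pi> where \<pi>: "\<pi> permutes {..<r}" "\<And>i. i < r \<Longrightarrow> q i 0 ^ m = lam (\<pi> i)"
    "\<And>i l. i < r \<Longrightarrow> l \<in> {1..n} \<Longrightarrow> q i l / q i 0 = u (\<pi> i) l"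
    using unique_up_to_permutation[OF decomposition_is_generic[OF q] dist] by blast
  have "tensor_power (q i) is = lam (\<pi> i) * tensor_power (hom1 (u (\<pi> i))) is"
    if i: "i < r" and "is": "is \<in> tuples m n" for i "is"
  proof -
    have "tensor_power (hom1 (\<lambda>l. q i l / q i 0)) is = tensor_power (hom1 (u (\<pi> i))) is"
      using "is" by (rule tensor_power_cong) (use \<pi>(3)[OF i] in \<open>auto simp: hom1_def\<close>)
    moreover have "length is = m" using "is" by (simp add: tuples_def)
    ultimately show ?thesis
      using tensor_power_dehomogenize[of "q i", OF first_coordinate_nonzero[OF q i]] \<pi>(2)[OF i] by simp
  qed
  with \<pi>(1) that show thesis by blast
qed

lemma rank_decompositions_agree:
  assumes q: "decomposes m n r F q" and q': "decomposes m n r F q'"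
    and dist: "\<forall>G. step1 m n k p r T G \<longrightarrow> distinct_eigenvalues (N_xi n k p r G \<xi>)"
  shows "\<exists>\<pi>. \<pi> permutes {..<r} \<and>
    (\<forall>i<r. tensor_eq m n (tensor_power (q' i)) (tensor_power (q (\<pi> i))))"
proof -
  obtain \<rho> where \<rho>: "\<rho> permutes {..<r}" "\<And>i is. i < r \<Longrightarrow> is \<in> tuples m n
      \<Longrightarrow> tensor_power (q i) is = lam (\<rho> i) * tensor_power (hom1 (u (\<rho> i))) is"
    using decomposition_terms[OF q dist] by blast
  obtain \<rho>' where \<rho>': "\<rho>' permutes {..<r}" "\<And>i is. i < r \<Longrightarrow> is \<in> tuples m n
      \<Longrightarrow> tensor_power (q' i) is = lam (\<rho>' i) * tensor_power (hom1 (u (\<rho>' i))) is"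
    using decomposition_terms[OF q' dist] by blast
  define \<pi> where "\<pi> = inv_into UNIV \<rho> \<circ> \<rho>'"
  have \<pi>: "\<pi> permutes {..<r}"
    unfolding \<pi>_def by (intro permutes_compose permutes_inv \<rho>(1) \<rho>'(1))
  have "tensor_power (q' i) is = tensor_power (q (\<pi> i)) is" if "i < r" "is \<in> tuples m n" for i "is"
  proof -
    have "\<rho> (\<pi> i) = \<rho>' i" by (simp add: \<pi>_def permutes_inverses[OF \<rho>(1)])
    moreover have "\<pi> i < r" using permutes_in_image[OF \<pi>, of i] that(1) by simp
    ultimately show ?thesis using \<rho>(2) \<rho>'(2) that by simp
  qed
  with \<pi> show ?thesis by (auto simp: tensor_eq_def)
qed

lemma algorithm_output_correct:
  assumes out: "algorithm_output m n k p r \<xi> T q"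
    and dist: "\<forall>G. step1 m n k p r T G \<longrightarrow> distinct_eigenvalues (N_xi n k p r G \<xi>)"
  shows "decomposes m n r F q" and "\<forall>i<r. \<forall>j\<in>{1..k}. determined i j"
proof -
  from out obtain G w v c where G: "step1 m n k p r T G" and w: "step2 n k p r \<xi> G w"
    and vc: "step3 m n k p r T w v c"
    and q: "\<And>i j. i < r \<Longrightarrow> j \<in> {0..n} \<Longrightarrow> q i j = c i powr (1 / of_nat m) * hom1 (join k v w i) j"
    unfolding algorithm_output_def by blast
  from G dist have d: "distinct_eigenvalues (N_xi n k p r G \<xi>)" by blast
  obtain \<sigma> where \<sigma>: "\<sigma> permutes {..<r}"
    and w\<sigma>: "\<And>i t. i < r \<Longrightarrow> t \<in> {1..n-k} \<Longrightarrow> w i t = u (\<sigma> i) (k + t)"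
    using step2_recovers_w[OF G d w] by blast
  interpret P: generic_decomposition m n k p r F "\<lambda>i. lam (\<sigma> i)" "\<lambda>i. u (\<sigma> i)"
    by (rule permuted[OF \<sigma>])
  have iff: "step3 m n k p r T w v c \<longleftrightarrow> (\<forall>j\<in>{1..k}. v j = (\<lambda>i\<in>{..<r}. u (\<sigma> i) j))
      \<and> (\<forall>i<r. \<forall>j\<in>{1..k}. P.determined i j) \<and> c = (\<lambda>i\<in>{..<r}. lam (\<sigma> i))"
    by (intro P.step3_iff w\<sigma>)
  from vc have v: "\<And>j. j \<in> {1..k} \<Longrightarrow> v j = (\<lambda>i\<in>{..<r}. u (\<sigma> i) j)"
    and vis: "\<forall>i<r. \<forall>j\<in>{1..k}. P.determined i j" and c: "c = (\<lambda>i\<in>{..<r}. lam (\<sigma> i))"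
    unfolding iff by blast+
  show "decomposes m n r F q"
  proof (rule P.decomposes_roots)
    fix i l assume i: "i < r" and l: "l \<le> n"
    have "join k v w i l = u (\<sigma> i) l" if "l \<noteq> 0"
      by (intro P.join_eq w\<sigma> v i) (use l that in auto)
    then have "hom1 (join k v w i) l = hom1 (u (\<sigma> i)) l" by (auto simp: hom1_def)
    with q[OF i, of l] l i show "q i l = lam (\<sigma> i) powr (1 / of_nat m) * hom1 (u (\<sigma> i)) l"
      by (simp add: c)
  qed
  show "\<forall>i<r. \<forall>j\<in>{1..k}. determined i j"
  proof (intro allI impI)
    fix i assume "i < r"
    moreover obtain i' where "i = \<sigma> i'" using permutes_surj[OF \<sigma>] by (metis surjD)
    ultimately show "\<forall>j\<in>{1..k}. determined i j"
      using permutes_in_image[OF \<sigma>, of i'] vis by (simp add: determined_def P.determined_def)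
  qed
qed

lemma ex_algorithm_output:
  assumes dist: "\<forall>G. step1 m n k p r T G \<longrightarrow> distinct_eigenvalues (N_xi n k p r G \<xi>)"
    and vis: "\<forall>i<r. \<forall>j\<in>{1..k}. determined i j"
  shows "\<exists>q. algorithm_output m n k p r \<xi> T q"
proof -
  obtain G where G: "step1 m n k p r T G" using ex_step1 by blast
  with dist have d: "distinct_eigenvalues (N_xi n k p r G \<xi>)" by blast
  let ?w = "\<lambda>i t. u i (k + t)" and ?v = "\<lambda>j. \<lambda>i\<in>{..<r}. u i j" and ?c = "\<lambda>i\<in>{..<r}. lam i"
  have "step3 m n k p r T ?w ?v ?c" using vis by (subst step3_iff) auto
  with G ex_step2[OF G d] have "algorithm_output m n k p r \<xi> T
      (\<lambda>i j. ?c i powr (1 / of_nat m) * hom1 (join k ?v ?w i) j)"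
    unfolding algorithm_output_def
    by (intro exI[of _ G] exI[of _ ?w] exI[of _ ?v] exI[of _ ?c]) simp
  then show ?thesis by (intro exI)
qed

end

theorem theorem3p5:
  fixes m n r p k :: nat
    and F :: tensor
    and u :: "nat \<Rightarrow> nat \<Rightarrow> complex"
    and lam \<xi> :: "nat \<Rightarrow> complex"
  assumes "m \<ge> 3" "n \<ge> 1" "r \<ge> 1"
    and "1 \<le> p" "p \<le> m - 2"
    and "p \<le> k" "k + m \<le> n + p"
    and "k choose p \<ge> r"
    and "(n - k - 1) choose (m - p - 1) \<ge> r"
    and "\<forall>i<r. lam i \<noteq> 0"
    and "tensor_eq m n F (\<lambda>is. \<Sum>i<r. lam i * tensor_power (hom1 (u i)) is)"
    and "lin_indep_on r u (B0 k p r)"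
    and "\<forall>\<alpha> \<in> B1 n k p. lin_indep_on r u (O_set m n k p \<alpha>)"
    and "\<forall>G. step1 m n k p r (restrict F (Omega m n)) G \<longrightarrow>
              distinct_eigenvalues (N_xi n k p r G \<xi>)"
  shows
    "(\<forall>q. algorithm_output m n k p r \<xi> (restrict F (Omega m n)) q \<longrightarrow>
          rank_decomposition m n r F q)
     \<and> ((\<exists>q. algorithm_output m n k p r \<xi> (restrict F (Omega m n)) q) \<longleftrightarrow>
          (\<forall>i<r. \<forall>j\<in>{1..k}. \<exists>\<beta>\<in>J1_minus k p j. mono_eval \<beta> (u i) \<noteq> 0))
     \<and> (\<exists>q. rank_decomposition m n r F q)
     \<and> (\<forall>q q'. rank_decomposition m n r F q \<and> rank_decomposition m n r F q' \<longrightarrow>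
          (\<exists>\<pi>. \<pi> permutes {..<r} \<and>
             (\<forall>i<r. tensor_eq m n (tensor_power (q' i)) (tensor_power (q (\<pi> i))))))"
proof -
  interpret generic_decomposition m n k p r F lam u
  proof
    show "p + 2 \<le> m" using assms(1,5) by linarith
    show "indep r (\<lambda>i \<beta>. mono_eval \<beta> (u i)) (B0 k p r)"
      using assms(12) unfolding lin_indep_on_def indep_def .
    show "indep r (\<lambda>i \<gamma>. mono_eval \<gamma> (u i)) (O_set m n k p \<alpha>)" if "\<alpha> \<in> B1 n k p" for \<alpha>
      using bspec[OF assms(13) that] unfolding lin_indep_on_def indep_def .
  qed (use assms in simp_all)
  note dist = assms(14)
  show ?thesis
    unfolding rank_decomposition_iff
  proof (intro conjI allI impI)
    show "decomposes m n r F q" if "algorithm_output m n k p r \<xi> T q" for q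
      using that dist by (rule algorithm_output_correct(1))
    show "(\<exists>q. algorithm_output m n k p r \<xi> T q) \<longleftrightarrow>
        (\<forall>i<r. \<forall>j\<in>{1..k}. \<exists>\<beta>\<in>J1_minus k p j. mono_eval \<beta> (u i) \<noteq> 0)"
      unfolding determined_def[symmetric]
      using algorithm_output_correct(2)[OF _ dist] ex_algorithm_output[OF dist] by blast
    show "\<exists>q. decomposes m n r F q" by (rule ex_decomposes)
    show "\<exists>\<pi>. \<pi> permutes {..<r} \<and>
        (\<forall>i<r. tensor_eq m n (tensor_power (q' i)) (tensor_power (q (\<pi> i))))"
      if "decomposes m n r F q \<and> decomposes m n r F q'" for q q'
      using conjunct1[OF that] conjunct2[OF that] dist by (rule rank_decompositions_agree)
  qed
qed

end
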